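(* Let $F=f+\psi:\mathbb{R}^n\to\mathbb{R}\cup\{+\infty\}$, the sampling $\hat S$ and the vector $v$ be as in the context, with $(f,\hat S)\sim\mathrm{ESO}(v)$. Assume that $F$ is $\mu$-strongly convex with respect to $\|\cdot\|_v$ for some $\mu>0$, so that $\mathcal{X}^*$ contains a unique element $x^*$ and $F(x)\ge F^*+\frac{\mu}{2}\|x-x^*\|_v^2$ for all $x$ with $F(x)<+\infty$. Let $\theta_0=\tau/n$ and $$\Delta(x)=\frac{1-\theta_0}{\theta_0^2}(F(x)-F^* )+\frac{1}{2\theta_0^2}\operatorname{dist}_v(x,\mathcal{X}^* )^2 .$$ Then the iterates $(x_k)$ of APPROX started at $x_0\in\operatorname{dom}\psi$ satisfy, for all $k\ge1$, $$\mathbf{E}[\Delta(x_k)]\le \frac{1+(1-\theta_0)\mu}{1+\frac{\theta_0^2}{2\theta_{k-1}^2}\mu}\,\Delta(x_0).$$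
   Context: Problem. $F(x)=f(x)+\psi(x)$ on $\mathbb{R}^n$, where $f:\mathbb{R}^n\to\mathbb{R}$ is convex and differentiable and $\psi(x)=\sum_{i=1}^n\psi^i(x^i)$ with each $\psi^i:\mathbb{R}\to\mathbb{R}\cup\{+\infty\}$ closed, proper and convex. $F^*$ is the minimum value of $F$ and $\mathcal{X}^*$ the set of minimizers, assumed nonempty. For a vector $v\in\mathbb{R}^n$ with positive entries, $\|x\|_v^2=\sum_i v_i(x^i)^2$ and $\operatorname{dist}_v(x,\mathcal{X}^* )$ is the distance to $\mathcal{X}^*$ in the norm $\|\cdot\|_v$. Sampling and ESO. $\hat S$ is a random subset of $\{1,\dots,n\}$ with $\mathbf{P}(i\in\hat S)=\mathbf{P}(j\in\hat S)$ for all $i,j$, and $\tau=\mathbf{E}[|\hat S|]>0$. For $h\in\mathbb{R}^n$, $h_{[S]}=\sum_{i\in S}h^ie_i$. $(f,\hat S)\sim\mathrm{ESO}(v)$ means: for all $x,h\in\mathbb{R}^n$, $\mathbf{E}[f(x+h_{[\hat S]})]\le f(x)+\frac{\tau}{n}\big(\langle\nabla f(x),h\rangle+\frac12\|h\|_v^2\big)$. APPROX: set $\theta_0=\tau/n$, $z_0=x_0$. For $k=0,1,2,\dots$: $y_k=(1-\theta_k)x_k+\theta_kz_k$; draw $S_k$ distributed as $\hat S$, independently of the past; for $i\in S_k$ set $z_{k+1}^i=\arg\min_{z\in\mathbb{R}}\{\nabla_if(y_k)(z-y_k^i)+\frac{\theta_knv_i}{2\tau}|z-z_k^i|^2+\psi^i(z)\}$,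 and $z_{k+1}^i=z_k^i$ for $i\notin S_k$; $x_{k+1}=y_k+\frac n\tau\theta_k(z_{k+1}-z_k)$; $\theta_{k+1}=\frac{\sqrt{\theta_k^4+4\theta_k^2}-\theta_k^2}{2}$. *)

theory Defs
  imports "HOL-Probability.Probability"
begin

text \<open>
  Vectors in \<open>\<real>\<^sup>n\<close> are elements of \<open>real ^ 'n\<close> with \<open>n = CARD('n)\<close>; functions with values in
  \<open>\<real> \<union> {+\<infinity>}\<close> are \<open>ereal\<close>-valued functions avoiding \<open>-\<infinity>\<close>.
\<close>

definition epi :: "('a \<Rightarrow> ereal) \<Rightarrow> ('a \<times> real) set" where
  "epi g = {(x, t). g x \<le> ereal t}"

definition closed_proper_convex :: "('a::real_normed_vector \<Rightarrow> ereal) \<Rightarrow> bool" where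
  "closed_proper_convex g \<longleftrightarrow>
     closed (epi g) \<and> convex (epi g) \<and> (\<forall>x. g x \<noteq> -\<infinity>) \<and> (\<exists>x. g x \<noteq> \<infinity>)"

definition separable_sum :: "('n::finite \<Rightarrow> real \<Rightarrow> ereal) \<Rightarrow> real ^ 'n \<Rightarrow> ereal" where
  "separable_sum \<psi> x = (\<Sum>i\<in>UNIV. \<psi> i (x $ i))"

definition composite ::
  "(real ^ 'n::finite \<Rightarrow> real) \<Rightarrow> ('n \<Rightarrow> real \<Rightarrow> ereal) \<Rightarrow> real ^ 'n \<Rightarrow> ereal" where
  "composite f \<psi> x = ereal (f x) + separable_sum \<psi> x"

definition edom :: "('a \<Rightarrow> ereal) \<Rightarrow> 'a set" where
  "edom g = {x. g x < \<infinity>}"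

definition minimizers :: "('a \<Rightarrow> ereal) \<Rightarrow> 'a set" where
  "minimizers F = {x. is_arg_min F (\<lambda>_. True) x}"

text \<open>The minimum of \<open>F\<close> whenever \<open>minimizers F\<close> is nonempty.\<close>
definition min_value :: "('a \<Rightarrow> ereal) \<Rightarrow> ereal" where
  "min_value F = (INF x. F x)"

definition wnorm :: "real ^ 'n::finite \<Rightarrow> real ^ 'n \<Rightarrow> real" where
  "wnorm v x = sqrt (\<Sum>i\<in>UNIV. v $ i * (x $ i)\<^sup>2)"

definition wdist :: "real ^ 'n::finite \<Rightarrow> real ^ 'n \<Rightarrow> (real ^ 'n) set \<Rightarrow> real" where
  "wdist v x A = (INF y\<in>A. wnorm v (x - y))"

definition strongly_convex_wrt ::
  "real ^ 'n::finite \<Rightarrow> real \<Rightarrow> (real ^ 'n \<Rightarrow> ereal) \<Rightarrow> bool" where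
  "strongly_convex_wrt v \<mu> F \<longleftrightarrow>
     (\<forall>x y t. 0 < t \<and> t < 1 \<longrightarrow>
        F ((1 - t) *\<^sub>R x + t *\<^sub>R y)
          \<le> ereal (1 - t) * F x + ereal t * F y
             - ereal (\<mu> / 2 * t * (1 - t) * (wnorm v (x - y))\<^sup>2))"

text \<open>A sampling is represented by its law on the finite type of subsets of the index type.\<close>

definition uniform_sampling :: "'n::finite set pmf \<Rightarrow> bool" where
  "uniform_sampling P \<longleftrightarrow>
     (\<forall>i j. measure_pmf.prob P {S. i \<in> S} = measure_pmf.prob P {S. j \<in> S})"

definition mean_size :: "'n::finite set pmf \<Rightarrow> real" where
  "mean_size P = measure_pmf.expectation P (\<lambda>S. real (card S))"

definition restrict_vec :: "'n set \<Rightarrow> real ^ 'n::finite \<Rightarrow> real ^ 'n" where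
  "restrict_vec S h = (\<chi> i. if i \<in> S then h $ i else 0)"

text \<open>The argument \<open>gradf\<close> stands for the gradient of \<open>f\<close>.\<close>
definition ESO ::
  "(real ^ 'n::finite \<Rightarrow> real) \<Rightarrow> (real ^ 'n \<Rightarrow> real ^ 'n) \<Rightarrow> 'n set pmf \<Rightarrow> real ^ 'n \<Rightarrow> bool" where
  "ESO f gradf P v \<longleftrightarrow>
     (\<forall>x h. measure_pmf.expectation P (\<lambda>S. f (x + restrict_vec S h))
        \<le> f x + mean_size P / real CARD('n) * (gradf x \<bullet> h + 1 / 2 * (wnorm v h)\<^sup>2))"

primrec theta :: "real \<Rightarrow> nat \<Rightarrow> real" where
  "theta \<theta>0 0 = \<theta>0"
| "theta \<theta>0 (Suc k) =
     (sqrt (theta \<theta>0 k ^ 4 + 4 * theta \<theta>0 k ^ 2) - theta \<theta>0 k ^ 2) / 2"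

text \<open>
  \<open>approx gradf \<psi> v \<tau> x0 S k\<close> is the pair \<open>(x\<^sub>k, z\<^sub>k)\<close> produced along one realisation \<open>S\<close> of the
  sequence of drawn subsets. The scalar subproblem has exactly one minimizer when \<open>v $ i > 0\<close>,
  \<open>\<tau> > 0\<close> and \<open>\<psi> i\<close> is closed, proper and convex, so that \<open>arg_min\<close> is then unambiguous.
\<close>
primrec approx ::
  "(real ^ 'n::finite \<Rightarrow> real ^ 'n) \<Rightarrow> ('n \<Rightarrow> real \<Rightarrow> ereal) \<Rightarrow> real ^ 'n \<Rightarrow> real \<Rightarrow> real ^ 'n
     \<Rightarrow> (nat \<Rightarrow> 'n set) \<Rightarrow> nat \<Rightarrow> (real ^ 'n) \<times> (real ^ 'n)" where
  "approx gradf \<psi> v \<tau> x0 S 0 = (x0, x0)"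
| "approx gradf \<psi> v \<tau> x0 S (Suc k) =
     (let n = real CARD('n);
          \<theta> = theta (\<tau> / n) k;
          (x, z) = approx gradf \<psi> v \<tau> x0 S k;
          y = (1 - \<theta>) *\<^sub>R x + \<theta> *\<^sub>R z;
          z' = (\<chi> i. if i \<in> S k
                 then arg_min (\<lambda>u. ereal (gradf y $ i * (u - y $ i)
                                     + \<theta> * n * v $ i / (2 * \<tau>) * \<bar>u - z $ i\<bar>\<^sup>2) + \<psi> i u)
                        (\<lambda>_. True)
                 else z $ i)
      in (y + (n / \<tau> * \<theta>) *\<^sub>R (z' - z), z'))"

definition approx_x ::
  "(real ^ 'n::finite \<Rightarrow> real ^ 'n) \<Rightarrow> ('n \<Rightarrow> real \<Rightarrow> ereal) \<Rightarrow> real ^ 'n \<Rightarrow> real \<Rightarrow> real ^ 'n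
     \<Rightarrow> (nat \<Rightarrow> 'n set) \<Rightarrow> nat \<Rightarrow> real ^ 'n" where
  "approx_x gradf \<psi> v \<tau> x0 S k = fst (approx gradf \<psi> v \<tau> x0 S k)"

definition Delta :: "real \<Rightarrow> real ^ 'n::finite \<Rightarrow> (real ^ 'n \<Rightarrow> ereal) \<Rightarrow> real ^ 'n \<Rightarrow> ereal" where
  "Delta \<theta>0 v F x =
     ereal ((1 - \<theta>0) / \<theta>0\<^sup>2) * (F x - min_value F)
     + ereal (1 / (2 * \<theta>0\<^sup>2) * (wdist v x (minimizers F))\<^sup>2)"

text \<open>
  Expectation of a nonnegative extended-real random variable; \<open>e2ennreal\<close> would truncate
  negative values. The value \<open>+\<infinity>\<close> is kept, so a finite upper bound on it includes almost sure finiteness.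
\<close>
definition ereal_expectation :: "'w measure \<Rightarrow> ('w \<Rightarrow> ereal) \<Rightarrow> ereal" where
  "ereal_expectation M X = enn2ereal (\<integral>\<^sup>+ \<omega>. e2ennreal (X \<omega>) \<partial>M)"

end

theory Submission
  imports Defs
begin

text \<open>
  Write \<open>\<theta>\<^sub>k\<close> for the step sizes, \<open>x\<^sup>*\<close> for the minimizer, \<open>\<Psi>\<close> for the sum of the \<open>\<psi>\<^sup>i\<close>, and
  measure all distances by \<open>\<parallel>\<cdot>\<parallel>\<^sub>v\<close>. The proof combines an estimate that holds in expectation and does
  not see strong convexity with a geometric fact that holds along every single run.

  In expectation: one iteration is controlled by the ESO inequality at \<open>y\<^sub>k\<close>, the tangent inequality
  of \<open>f\<close> at \<open>y\<^sub>k\<close> and the three-point inequality of the proximal step (\<open>one_step\<close>). For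
  \<open>\<theta>\<^sub>0 < 1\<close> the point \<open>x\<^sub>k\<^sub>+\<^sub>1\<close> extrapolates along \<open>z\<^sub>k\<^sub>+\<^sub>1 - z\<^sub>k\<close>, so \<open>\<Psi>(x\<^sub>k\<^sub>+\<^sub>1)\<close> cannot be bounded by
  convexity from \<open>x\<^sub>k\<close>, \<open>z\<^sub>k\<close> and \<open>z\<^sub>k\<^sub>+\<^sub>1\<close>; it is replaced by the
  number \<open>Psihat\<close> that follows the recursion of \<open>x\<^sub>k\<close> with \<open>\<Psi>(z\<^sub>k)\<close> in place of \<open>z\<^sub>k\<close>. With this
  surrogate the potential \<open>(f(x\<^sub>k) + Psihat\<^sub>k - F\<^sup>*) / \<theta>\<^sub>k\<^sub>-\<^sub>1\<^sup>2 + \<parallel>z\<^sub>k - x\<^sup>*\<parallel>\<^sup>2 / (2 \<theta>\<^sub>0\<^sup>2)\<close> is a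
  supermartingale (\<open>potential_step\<close>). With \<open>(1 - \<theta>\<^sub>0) / \<theta>\<^sub>0\<^sup>2\<close> as the first factor at \<open>k = 0\<close>, it starts at
  \<open>\<Delta>(x\<^sub>0)\<close>.

  Along every run: \<open>x\<^sub>k = g\<^sub>k z\<^sub>k + (1 - g\<^sub>k) R\<^sub>k\<close> with \<open>g\<^sub>k = \<theta>\<^sub>k\<^sub>-\<^sub>1 / \<theta>\<^sub>0\<close>, where \<open>R\<^sub>k\<^sub>+\<^sub>1\<close> is a convex
  combination of \<open>x\<^sub>k\<close> and \<open>R\<^sub>k\<close> (\<open>X_split\<close>, \<open>R_step\<close>). Thus every convex function can be propagated
  along the run. For \<open>\<Psi>\<close> this gives \<open>\<Psi>(x\<^sub>k) \<le> Psihat\<^sub>k\<close>; for the squared distance to \<open>x\<^sup>*\<close> it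
  bounds \<open>\<parallel>x\<^sub>k - x\<^sup>*\<parallel>\<^sup>2\<close> by \<open>\<parallel>z\<^sub>k - x\<^sup>*\<parallel>\<^sup>2\<close> and \<open>\<parallel>R\<^sub>k - x\<^sup>*\<parallel>\<^sup>2\<close>.

  Strong convexity enters only as \<open>F(x\<^sub>k) - F\<^sup>* \<ge> \<mu>/2 \<parallel>x\<^sub>k - x\<^sup>*\<parallel>\<^sup>2\<close>: when \<open>x\<^sub>k\<close> is far from \<open>x\<^sup>*\<close>, the
  potential bound forces \<open>z\<^sub>k\<close> to be close, and then \<open>x\<^sub>k\<close> is close as well. After taking expectations
  this is a coupled recursion of real numbers, and \<open>rate_of_coupled_recursion\<close> solves it. With
  \<open>u\<^sub>k = \<mu> \<theta>\<^sub>0\<^sup>2 / (2 \<theta>\<^sub>k\<^sub>-\<^sub>1\<^sup>2)\<close>, the inductive invariant is that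
  \<open>(1 - g\<^sub>k) \<parallel>R\<^sub>k - x\<^sup>*\<parallel>\<^sup>2 / (2 \<theta>\<^sub>0\<^sup>2)\<close> has expectation at most
  \<open>(1 - g\<^sub>k + g\<^sub>k u\<^sub>k) / (1 + u\<^sub>k) \<Delta>(x\<^sub>0)\<close>, which is exactly what makes the expectation of
  \<open>\<parallel>x\<^sub>k - x\<^sup>*\<parallel>\<^sup>2 / (2 \<theta>\<^sub>0\<^sup>2)\<close> at most \<open>\<Delta>(x\<^sub>0) / (1 + u\<^sub>k)\<close>.
\<close>

section \<open>Closed convex functions on the line and the proximal step\<close>

text \<open>
  Growth above a minimum: \<open>a\<close> is the minimal value of a strongly convex function, \<open>b\<close> its value at
  the other end of a segment that starts at the minimizer, and the right-hand side bounds its value at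
  parameter \<open>t\<close>. Cancelling \<open>a\<close> and dividing by \<open>t\<close> leaves \<open>a + d (1 - t) \<le> b\<close>, and \<open>t\<close> tends
  to \<open>0\<close>.
\<close>
lemma le_of_interpolation:
  fixes a b d :: real
  assumes "\<And>t. 0 < t \<Longrightarrow> t < 1 \<Longrightarrow> a \<le> (1 - t) * a + t * b - d * t * (1 - t)"
  shows "a + d \<le> b"
proof -
  have *: "a + d * (1 - t) \<le> b" if t: "0 < t" "t < 1" for t
  proof -
    have "t * (a + d * (1 - t)) \<le> t * b"
      using assms[OF t] by (simp add: algebra_simps)
    then show ?thesis using t by simp
  qed
  have "((\<lambda>t. a + d * (1 - t)) \<longlongrightarrow> a + d * (1 - 0)) (at_right 0)"
    by (intro tendsto_intros)
  moreover have "\<forall>\<^sub>F t in at_right 0. a + d * (1 - t) \<le> b"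
    using * eventually_at_right[of 0 "1::real"] by (auto intro!: exI[of _ 1])
  ultimately have "a + d * (1 - 0) \<le> b"
    by (intro tendsto_upperbound[where F = "at_right (0::real)"]) auto
  then show ?thesis by simp
qed

text \<open>
  The sublevel sets at the finite values taken on \<open>K\<close> are closed, meet \<open>K\<close> and form a chain, so by
  compactness they have a common point in \<open>K\<close>.
\<close>
lemma ereal_lsc_attains_min:
  fixes \<phi> :: "'a::t2_space \<Rightarrow> ereal"
  assumes K: "compact K" "K \<noteq> {}"
    and lsc: "\<And>t. closed {u. \<phi> u \<le> ereal t}"
    and fin: "\<And>u. \<phi> u \<noteq> -\<infinity>"
  shows "\<exists>u\<in>K. \<forall>w\<in>K. \<phi> u \<le> \<phi> w"
proof (cases "\<forall>w\<in>K. \<phi> w = \<infinity>")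
  case True
  then show ?thesis using K by auto
next
  case False
  define W where "W = {w\<in>K. \<phi> w \<noteq> \<infinity>}"
  have "K \<inter> (\<Inter>w\<in>W. {u. \<phi> u \<le> \<phi> w}) \<noteq> {}"
  proof (rule compact_imp_fip_image[OF \<open>compact K\<close>])
    fix w assume "w \<in> W"
    then obtain t where "\<phi> w = ereal t"
      using fin[of w] by (cases "\<phi> w") (auto simp: W_def)
    then show "closed {u. \<phi> u \<le> \<phi> w}" using lsc by simp
  next
    fix W' assume W': "finite W'" "W' \<subseteq> W"
    show "K \<inter> (\<Inter>w\<in>W'. {u. \<phi> u \<le> \<phi> w}) \<noteq> {}"
    proof (cases "W' = {}")
      case True then show ?thesis using K by simp
    next
      case False
      then have "Min (\<phi> ` W') \<in> \<phi> ` W'" using W'(1) by (intro Min_in) auto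
      then obtain u where "u \<in> W'" "\<phi> u = Min (\<phi> ` W')" by (metis imageE)
      then have "u \<in> W'" "\<forall>w\<in>W'. \<phi> u \<le> \<phi> w" using W'(1) by auto
      then show ?thesis using W'(2) by (auto simp: W_def)
    qed
  qed
  then obtain u where u: "u \<in> K" "\<And>w. w \<in> W \<Longrightarrow> \<phi> u \<le> \<phi> w" by auto
  have "\<phi> u \<le> \<phi> w" if "w \<in> K" for w
    using u(2)[of w] that by (cases "\<phi> w = \<infinity>") (auto simp: W_def)
  with u(1) show ?thesis by blast
qed

lemma edom_real:
  assumes "closed_proper_convex g" "u \<in> edom g"
  shows "g u = ereal (real_of_ereal (g u))"
  using assms by (cases "g u") (auto simp: closed_proper_convex_def edom_def)

lemma edom_add_le_iff:
  assumes "closed_proper_convex g" "u \<in> edom g" "w \<in> edom g"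
  shows "ereal x + g u \<le> ereal y + g w \<longleftrightarrow> x + real_of_ereal (g u) \<le> y + real_of_ereal (g w)"
  using assms by (cases "g u"; cases "g w") (auto simp: closed_proper_convex_def edom_def)

lemma closed_proper_convex_convex_on:
  fixes g :: "'a::real_normed_vector \<Rightarrow> ereal"
  assumes g: "closed_proper_convex g"
  shows "convex_on (edom g) (\<lambda>u. real_of_ereal (g u))"
proof -
  have *: "g ((1 - t) *\<^sub>R x + t *\<^sub>R y) \<le> ereal ((1 - t) * real_of_ereal (g x) + t * real_of_ereal (g y))"
    if "0 \<le> t" "t \<le> 1" "x \<in> edom g" "y \<in> edom g" for t x y
  proof -
    have "(x, real_of_ereal (g x)) \<in> epi g" "(y, real_of_ereal (g y)) \<in> epi g"
      using edom_real[OF g that(3)] edom_real[OF g that(4)] by (auto simp: epi_def)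
    moreover have "convex (epi g)" using g by (simp add: closed_proper_convex_def)
    ultimately have "(1 - t) *\<^sub>R (x, real_of_ereal (g x)) + t *\<^sub>R (y, real_of_ereal (g y)) \<in> epi g"
      using that unfolding convex_alt by blast
    then show ?thesis by (simp add: epi_def)
  qed
  have dom: "(1 - t) *\<^sub>R x + t *\<^sub>R y \<in> edom g"
    if "0 \<le> t" "t \<le> 1" "x \<in> edom g" "y \<in> edom g" for t x y
    using *[OF that] by (auto simp: edom_def intro: le_less_trans)
  show ?thesis
  proof (rule convex_onI)
    show "convex (edom g)" using dom by (auto simp: convex_alt)
    fix t x y assume t: "0 < (t::real)" "t < 1" "x \<in> edom g" "y \<in> edom g"
    have "ereal (real_of_ereal (g ((1 - t) *\<^sub>R x + t *\<^sub>R y))) = g ((1 - t) *\<^sub>R x + t *\<^sub>R y)"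
      using edom_real[OF g dom[of t x y]] t by simp
    also have "\<dots> \<le> ereal ((1 - t) * real_of_ereal (g x) + t * real_of_ereal (g y))"
      using *[of t x y] t by simp
    finally show "real_of_ereal (g ((1 - t) *\<^sub>R x + t *\<^sub>R y))
        \<le> (1 - t) * real_of_ereal (g x) + t * real_of_ereal (g y)" by simp
  qed
qed

text \<open>
  Adding a continuous function keeps lower semicontinuity: the sublevel set is the preimage of the
  closed epigraph under \<open>u \<mapsto> (u, t - q u)\<close>.
\<close>
lemma closed_sublevel_add_continuous:
  fixes g :: "'a::real_normed_vector \<Rightarrow> ereal"
  assumes g: "closed_proper_convex g" and q: "continuous_on UNIV q"
  shows "closed {u. ereal (q u) + g u \<le> ereal t}"
proof -
  have "{u. ereal (q u) + g u \<le> ereal t} = (\<lambda>u. (u, t - q u)) -` epi g"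
  proof -
    have "ereal (q u) + g u \<le> ereal t \<longleftrightarrow> g u \<le> ereal (t - q u)" for u
      by (cases "g u") auto
    then show ?thesis by (auto simp: epi_def)
  qed
  moreover have "closed ((\<lambda>u. (u, t - q u)) -` epi g)"
    using g q by (intro closed_vimage continuous_on_Pair continuous_on_diff continuous_on_const continuous_on_id)
      (simp add: closed_proper_convex_def)
  ultimately show ?thesis by simp
qed

text \<open>
  On the unit interval around \<open>u0\<close> the function is bounded below by compactness. Convexity
  transports this bound outwards, because the segment from \<open>u0\<close> to a distant \<open>u\<close> leaves the
  interval at a point where the value is already bounded below.
\<close>
lemma linear_minorant:
  fixes g :: "real \<Rightarrow> ereal"
  assumes g: "closed_proper_convex g" and u0: "u0 \<in> edom g"
  obtains \<alpha> \<beta> where "\<And>u. u \<in> edom g \<Longrightarrow> - \<alpha> - \<beta> * \<bar>u - u0\<bar> \<le> real_of_ereal (g u)" "\<alpha> \<ge> 0" "\<beta> \<ge> 0"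
proof -
  let ?r = "\<lambda>u. real_of_ereal (g u)"
  have "\<exists>u\<in>{u0-1..u0+1}. \<forall>w\<in>{u0-1..u0+1}. g u \<le> g w"
  proof (rule ereal_lsc_attains_min)
    show "closed {u. g u \<le> ereal t}" for t
      using closed_sublevel_add_continuous[OF g, of "\<lambda>_. 0" t] by (simp add: zero_ereal_def[symmetric])
    show "g u \<noteq> -\<infinity>" for u using g by (auto simp: closed_proper_convex_def)
  qed auto
  then obtain m where m: "m \<in> {u0-1..u0+1}" "\<And>w. w \<in> {u0-1..u0+1} \<Longrightarrow> g m \<le> g w" by blast
  have "g m \<le> g u0" by (rule m(2)) auto
  with u0 have mdom: "m \<in> edom g" by (auto simp: edom_def intro: le_less_trans)
  have near: "?r m \<le> ?r w" if "w \<in> edom g" "\<bar>w - u0\<bar> \<le> 1" for w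
  proof -
    have "g m \<le> g w" using that by (intro m(2)) auto
    then show ?thesis using edom_add_le_iff[OF g mdom that(1), of 0 0] by (simp add: zero_ereal_def[symmetric])
  qed
  have cvx: "convex_on (edom g) ?r" by (rule closed_proper_convex_convex_on[OF g])
  define \<beta> where "\<beta> = ?r u0 - ?r m"
  define \<alpha> where "\<alpha> = \<bar>?r m\<bar> + \<bar>?r u0\<bar>"
  have b: "\<beta> \<ge> 0" using near[OF u0] by (simp add: \<beta>_def)
  have "- \<alpha> - \<beta> * \<bar>u - u0\<bar> \<le> ?r u" if u: "u \<in> edom g" for u
  proof (cases "\<bar>u - u0\<bar> \<le> 1")
    case True
    have "\<beta> * \<bar>u - u0\<bar> \<ge> 0" using b by simp
    then show ?thesis using near[OF u True] unfolding \<alpha>_def by linarith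
  next
    case False
    define t where "t = 1 / \<bar>u - u0\<bar>"
    have t: "0 < t" "t < 1" using False by (auto simp: t_def)
    define w where "w = (1 - t) *\<^sub>R u0 + t *\<^sub>R u"
    have "w \<in> edom g" using cvx u u0 t by (auto simp: w_def convex_on_def convex_alt)
    moreover have "\<bar>w - u0\<bar> \<le> 1"
    proof -
      have "w - u0 = t * (u - u0)" by (simp add: w_def algebra_simps)
      then show ?thesis using False by (simp add: abs_mult t_def)
    qed
    ultimately have "?r m \<le> ?r w" by (rule near)
    also have "\<dots> \<le> (1 - t) * ?r u0 + t * ?r u"
      using convex_onD[OF cvx, of t u0 u] t u u0 by (simp add: w_def)
    finally have "t * (?r u0 - ?r u) \<le> \<beta>" by (simp add: \<beta>_def algebra_simps)
    then have "?r u0 - ?r u \<le> \<beta> / t" using t by (simp add: field_simps)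
    also have "\<beta> / t = \<beta> * \<bar>u - u0\<bar>" by (simp add: t_def)
    finally show ?thesis unfolding \<alpha>_def by linarith
  qed
  moreover have "\<alpha> \<ge> 0" unfolding \<alpha>_def by linarith
  ultimately show thesis using that b by blast
qed

text \<open>
  By the linear minorant, the quadratic term dominates far away from a point \<open>u0\<close> of the domain, so
  that the minimum over a large compact interval is global.
\<close>
lemma prox_exists:
  fixes g :: "real \<Rightarrow> ereal" and b c y z :: real
  assumes g: "closed_proper_convex g" and c: "c > 0"
  shows "\<exists>u. is_arg_min (\<lambda>u. ereal (b * (u - y) + c * \<bar>u - z\<bar>\<^sup>2) + g u) (\<lambda>_. True) u"
proof -
  let ?q = "\<lambda>u. b * (u - y) + c * \<bar>u - z\<bar>\<^sup>2"
  let ?r = "\<lambda>u. real_of_ereal (g u)"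
  obtain u0 where u0: "u0 \<in> edom g" using g by (auto simp: closed_proper_convex_def edom_def)
  obtain \<alpha> \<beta> where ab: "\<And>u. u \<in> edom g \<Longrightarrow> - \<alpha> - \<beta> * \<bar>u - u0\<bar> \<le> ?r u" "\<alpha> \<ge> 0" "\<beta> \<ge> 0"
    using linear_minorant[OF g u0] by blast
  define e where "e = b + 2 * c * (u0 - z)"
  define K where "K = \<alpha> + \<bar>?r u0\<bar>"
  \<comment> \<open>Expanded around \<open>u0\<close>, the quadratic part has slope \<open>e\<close>; the minorant and the value at \<open>u0\<close> account
  for at most \<open>\<beta> * \<bar>d\<bar> + K\<close>. Beyond \<open>R\<close> the term \<open>c * d\<^sup>2\<close> outweighs all of this.\<close>
  define R where "R = (\<bar>e\<bar> + \<beta> + K) / c + 1"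
  have K: "K \<ge> 0" using ab(2) unfolding K_def by linarith
  have R: "R \<ge> 1" using c ab K by (simp add: R_def)
  have far: "ereal (?q u0) + g u0 \<le> ereal (?q u) + g u" if "\<bar>u - u0\<bar> > R" for u
  proof (cases "u \<in> edom g")
    case False
    then show ?thesis by (auto simp: edom_def)
  next
    case True
    define d where "d = u - u0"
    have q: "?q u = ?q u0 + e * d + c * d\<^sup>2"
      unfolding power2_abs d_def e_def by (simp add: power2_eq_square algebra_simps)
    have d: "\<bar>d\<bar> > R" using that by (simp add: d_def)
    have "c * \<bar>d\<bar> \<ge> c * R" using d c by simp
    moreover have "c * R = \<bar>e\<bar> + \<beta> + K + c" using c by (simp add: R_def field_simps)
    ultimately have "(c * \<bar>d\<bar> - \<bar>e\<bar> - \<beta>) \<ge> K" using c by simp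
    then have "\<bar>d\<bar> * (c * \<bar>d\<bar> - \<bar>e\<bar> - \<beta>) \<ge> 1 * K"
      using d R K by (intro mult_mono) auto
    then have "c * d\<^sup>2 \<ge> \<bar>e\<bar> * \<bar>d\<bar> + \<beta> * \<bar>d\<bar> + K"
      by (simp add: algebra_simps power2_eq_square abs_mult[symmetric])
    moreover have "e * d \<ge> - (\<bar>e\<bar> * \<bar>d\<bar>)" by (metis abs_ge_minus_self abs_mult minus_le_iff)
    moreover have "?r u \<ge> - \<alpha> - \<beta> * \<bar>d\<bar>" using ab(1)[OF True] by (simp add: d_def)
    ultimately have "?q u0 + ?r u0 \<le> ?q u + ?r u" unfolding q K_def by linarith
    then show ?thesis by (simp add: edom_add_le_iff[OF g u0 True])
  qed
  have "\<exists>u\<in>{u0-R..u0+R}. \<forall>w\<in>{u0-R..u0+R}. ereal (?q u) + g u \<le> ereal (?q w) + g w"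
  proof (rule ereal_lsc_attains_min)
    show "closed {u. ereal (?q u) + g u \<le> ereal t}" for t
      by (intro closed_sublevel_add_continuous[OF g] continuous_intros)
    show "ereal (?q u) + g u \<noteq> -\<infinity>" for u using g by (auto simp: closed_proper_convex_def)
  qed (use R in auto)
  then obtain m where m: "\<And>w. w \<in> {u0-R..u0+R} \<Longrightarrow> ereal (?q m) + g m \<le> ereal (?q w) + g w" by blast
  have "ereal (?q m) + g m \<le> ereal (?q w) + g w" for w
  proof (cases "\<bar>w - u0\<bar> > R")
    case True
    have "ereal (?q m) + g m \<le> ereal (?q u0) + g u0" using R by (intro m) auto
    then show ?thesis using far[OF True] by (rule order_trans)
  next
    case False
    then show ?thesis by (intro m) auto
  qed
  then have "is_arg_min (\<lambda>u. ereal (?q u) + g u) (\<lambda>_. True) m"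
    by (auto simp: is_arg_min_def not_less)
  then show ?thesis by blast
qed

text \<open>
  The objective of the scalar subproblem is the sum of a convex function and a quadratic with leading
  coefficient \<open>c\<close>; hence it exceeds its minimum by at least \<open>c (w - p)\<^sup>2\<close> at every point \<open>w\<close> of the
  domain.
\<close>
lemma prox_three_point:
  fixes g :: "real \<Rightarrow> ereal" and b c y z :: real
  assumes g: "closed_proper_convex g" and c: "c > 0"
  defines "p \<equiv> arg_min (\<lambda>u. ereal (b * (u - y) + c * \<bar>u - z\<bar>\<^sup>2) + g u) (\<lambda>_. True)"
  shows prox_in_edom: "p \<in> edom g"
    and prox_ineq: "w \<in> edom g \<Longrightarrow>
      b * (p - y) + c * (p - z)\<^sup>2 + real_of_ereal (g p) + c * (w - p)\<^sup>2
        \<le> b * (w - y) + c * (w - z)\<^sup>2 + real_of_ereal (g w)"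
proof -
  let ?q = "\<lambda>u. b * (u - y) + c * \<bar>u - z\<bar>\<^sup>2"
  let ?r = "\<lambda>u. real_of_ereal (g u)"
  have "is_arg_min (\<lambda>u. ereal (?q u) + g u) (\<lambda>_. True) p"
    unfolding p_def arg_min_def using prox_exists[OF g c] by (rule someI_ex)
  then have min: "ereal (?q p) + g p \<le> ereal (?q w) + g w" for w
    by (auto simp: is_arg_min_def not_less)
  obtain u0 where u0: "u0 \<in> edom g" using g by (auto simp: closed_proper_convex_def edom_def)
  show p: "p \<in> edom g"
    using min[of u0] u0 by (auto simp: edom_def)
  have minr: "?q p + ?r p \<le> ?q w + ?r w" if "w \<in> edom g" for w
    using min[of w] by (simp add: edom_add_le_iff[OF g p that])
  have cvx: "convex_on (edom g) ?r" by (rule closed_proper_convex_convex_on[OF g])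
  assume w: "w \<in> edom g"
  have "?q p + ?r p + c * (w - p)\<^sup>2 \<le> ?q w + ?r w"
  proof (rule le_of_interpolation)
    fix t :: real assume t: "0 < t" "t < 1"
    let ?w = "(1 - t) *\<^sub>R p + t *\<^sub>R w"
    have "?w \<in> edom g" using cvx p w t by (auto simp: convex_on_def convex_alt)
    then have "?q p + ?r p \<le> ?q ?w + ?r ?w" by (rule minr)
    also have "?r ?w \<le> (1 - t) * ?r p + t * ?r w"
      using convex_onD[OF cvx, of t p w] t p w by simp
    also have "?q ?w = (1 - t) * ?q p + t * ?q w - c * (w - p)\<^sup>2 * t * (1 - t)"
      unfolding power2_abs real_scaleR_def by (simp add: power2_eq_square algebra_simps)
    finally show "?q p + ?r p \<le> (1 - t) * (?q p + ?r p) + t * (?q w + ?r w) - c * (w - p)\<^sup>2 * t * (1 - t)"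
      by (simp add: algebra_simps)
  qed
  then show "b * (p - y) + c * (p - z)\<^sup>2 + ?r p + c * (w - p)\<^sup>2 \<le> b * (w - y) + c * (w - z)\<^sup>2 + ?r w"
    by simp
qed

section \<open>Gradients, convex combinations and the weighted norm\<close>

text \<open>
  Restricting \<open>f\<close> to the line through \<open>y\<close> and \<open>x\<close> reduces this to the tangent inequality for convex
  functions of one real variable.
\<close>
lemma convex_ge_tangent:
  fixes f :: "'a::real_inner \<Rightarrow> real"
  assumes cvx: "convex_on UNIV f" and d: "GDERIV f y :> g"
  shows "f y + g \<bullet> (x - y) \<le> f x"
proof -
  let ?l = "\<lambda>t::real. y + t *\<^sub>R (x - y)"
  have "convex_on UNIV (\<lambda>t. f (?l t))"
  proof (rule convex_onI)
    fix t a b :: real assume t: "0 < t" "t < 1"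
    have "?l ((1 - t) *\<^sub>R a + t *\<^sub>R b) = (1 - t) *\<^sub>R ?l a + t *\<^sub>R ?l b"
      by (simp add: algebra_simps)
    then show "f (?l ((1 - t) *\<^sub>R a + t *\<^sub>R b)) \<le> (1 - t) * f (?l a) + t * f (?l b)"
      using convex_onD[OF cvx, of t "?l a" "?l b"] t by simp
  qed simp
  moreover have "((\<lambda>t. f (?l t)) has_field_derivative g \<bullet> (x - y)) (at 0)"
  proof -
    have "(f has_derivative (\<lambda>h. g \<bullet> h)) (at (?l 0))"
      using d by (simp add: gderiv_def inner_commute)
    moreover have "(?l has_derivative (\<lambda>t. t *\<^sub>R (x - y))) (at 0)"
      by (auto intro!: derivative_eq_intros)
    ultimately have "((\<lambda>t. f (?l t)) has_derivative (\<lambda>t. g \<bullet> (t *\<^sub>R (x - y)))) (at 0)"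
      by (rule has_derivative_compose[rotated])
    then show ?thesis by (simp add: has_field_derivative_def mult_commute_abs)
  qed
  ultimately have "f (?l 1) - f (?l 0) \<ge> g \<bullet> (x - y) * (1 - 0)"
    by (intro convex_on_imp_above_tangent[where A = UNIV]) auto
  then show ?thesis by simp
qed

lemma convex_on_scaled_combination:
  assumes cvx: "convex_on C \<Phi>" and xy: "x \<in> C" "y \<in> C" and ab: "0 \<le> a" "0 \<le> b" "0 < a + b"
  shows "(1 / (a + b)) *\<^sub>R (a *\<^sub>R x + b *\<^sub>R y) \<in> C"
    and "(a + b) * \<Phi> ((1 / (a + b)) *\<^sub>R (a *\<^sub>R x + b *\<^sub>R y)) \<le> a * \<Phi> x + b * \<Phi> y"
proof -
  have sum1: "a / (a + b) + b / (a + b) = 1" "0 \<le> a / (a + b)" "0 \<le> b / (a + b)"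
    using ab by (auto simp: add_divide_distrib[symmetric])
  have eq: "(1 / (a + b)) *\<^sub>R (a *\<^sub>R x + b *\<^sub>R y) = (a / (a + b)) *\<^sub>R x + (b / (a + b)) *\<^sub>R y"
    by (simp add: scaleR_add_right)
  show "(1 / (a + b)) *\<^sub>R (a *\<^sub>R x + b *\<^sub>R y) \<in> C"
    unfolding eq using cvx sum1 xy by (simp add: convex_on_def convex_def)
  have "\<Phi> ((a / (a + b)) *\<^sub>R x + (b / (a + b)) *\<^sub>R y) \<le> a / (a + b) * \<Phi> x + b / (a + b) * \<Phi> y"
    using cvx sum1 xy unfolding convex_on_def by blast
  then have "(a + b) * \<Phi> ((a / (a + b)) *\<^sub>R x + (b / (a + b)) *\<^sub>R y)
      \<le> (a + b) * (a / (a + b) * \<Phi> x + b / (a + b) * \<Phi> y)"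
    using ab by (intro mult_left_mono) auto
  also have "\<dots> = a * \<Phi> x + b * \<Phi> y"
    using ab by (simp add: distrib_left)
  finally show "(a + b) * \<Phi> ((1 / (a + b)) *\<^sub>R (a *\<^sub>R x + b *\<^sub>R y)) \<le> a * \<Phi> x + b * \<Phi> y"
    unfolding eq .
qed

lemma wnorm_sq:
  assumes "\<And>i. v $ i > 0"
  shows "(wnorm v x)\<^sup>2 = (\<Sum>i\<in>UNIV. v $ i * (x $ i)\<^sup>2)"
  unfolding wnorm_def by (intro real_sqrt_pow2 sum_nonneg mult_nonneg_nonneg) (auto simp: assms less_imp_le)

lemma convex_on_wnorm_sq:
  assumes v: "\<And>i. v $ i > 0"
  shows "convex_on UNIV (\<lambda>x. (wnorm v (x - w))\<^sup>2)"
proof (rule convex_onI)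
  fix t :: real and x y :: "real ^ 'a"
  assume t: "0 < t" "t < 1"
  have "v $ i * (((1 - t) *\<^sub>R x + t *\<^sub>R y - w) $ i)\<^sup>2
      \<le> (1 - t) * (v $ i * ((x - w) $ i)\<^sup>2) + t * (v $ i * ((y - w) $ i)\<^sup>2)" for i
  proof -
    have "(1 - t) * (v $ i * ((x - w) $ i)\<^sup>2) + t * (v $ i * ((y - w) $ i)\<^sup>2)
        - v $ i * (((1 - t) *\<^sub>R x + t *\<^sub>R y - w) $ i)\<^sup>2 = t * (1 - t) * (v $ i * (x $ i - y $ i)\<^sup>2)"
      by (simp add: power2_eq_square algebra_simps)
    also have "\<dots> \<ge> 0" using t v[of i] by simp
    finally show ?thesis by simp
  qed
  then show "(wnorm v ((1 - t) *\<^sub>R x + t *\<^sub>R y - w))\<^sup>2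
      \<le> (1 - t) * (wnorm v (x - w))\<^sup>2 + t * (wnorm v (y - w))\<^sup>2"
    unfolding wnorm_sq[OF v] sum_distrib_left sum.distrib[symmetric] by (intro sum_mono)
qed simp

lemma wnorm_eq_0_iff:
  assumes v: "\<And>i. v $ i > 0"
  shows "(wnorm v x)\<^sup>2 = 0 \<longleftrightarrow> x = 0"
proof -
  have "(wnorm v x)\<^sup>2 = 0 \<longleftrightarrow> (\<forall>i. v $ i * (x $ i)\<^sup>2 = 0)"
    unfolding wnorm_sq[OF v] using v by (subst sum_nonneg_eq_0_iff) (auto simp: less_imp_le)
  also have "\<dots> \<longleftrightarrow> x = 0"
    using v by (auto simp: vec_eq_iff) (metis less_irrefl)
  finally show ?thesis .
qed

section \<open>The step sizes and the weights of the iterates\<close>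

text \<open>
  The recursion selects the positive root of \<open>r\<^sup>2 = (1 - r) \<theta>\<^sub>k\<^sup>2\<close>; the analysis uses this identity,
  positivity and \<open>\<theta>\<^sub>k \<le> \<theta>\<^sub>0\<close>.
\<close>
lemma theta_facts:
  assumes "0 < \<theta>0" "\<theta>0 \<le> 1"
  shows theta_pos: "theta \<theta>0 k > 0" and theta_le: "theta \<theta>0 k \<le> \<theta>0"
    and theta_Suc_sq: "(theta \<theta>0 (Suc k))\<^sup>2 = (1 - theta \<theta>0 (Suc k)) * (theta \<theta>0 k)\<^sup>2"
proof -
  have *: "0 < r \<and> r \<le> t \<and> r\<^sup>2 = (1 - r) * t\<^sup>2"
    if t: "t > 0" and r: "r = (sqrt (t ^ 4 + 4 * t\<^sup>2) - t\<^sup>2) / 2" for r t :: real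
  proof -
    have rt: "(2 * r + t\<^sup>2)\<^sup>2 = t ^ 4 + 4 * t\<^sup>2"
    proof -
      have "2 * r + t\<^sup>2 = sqrt (t ^ 4 + 4 * t\<^sup>2)" using r by (simp add: field_simps)
      then show ?thesis by simp
    qed
    have "sqrt (t ^ 4 + 4 * t\<^sup>2) > sqrt ((t\<^sup>2)\<^sup>2)"
      using t by (intro real_sqrt_less_mono) (simp add: power2_eq_square power4_eq_xxxx)
    then have "sqrt (t ^ 4 + 4 * t\<^sup>2) > t\<^sup>2" unfolding real_sqrt_abs by simp
    then have r0: "r > 0" unfolding r by simp
    have sq: "r\<^sup>2 = (1 - r) * t\<^sup>2"
      using rt by (simp add: power2_eq_square power4_eq_xxxx algebra_simps)
    also have "\<dots> \<le> t\<^sup>2" using r0 by (simp add: algebra_simps)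
    finally have "r \<le> t" using t by (simp add: power2_le_iff_abs_le)
    then show ?thesis using r0 sq by simp
  qed
  have pos: "theta \<theta>0 k > 0" for k
    by (induction k) (use assms *[OF _ refl] in auto)
  then show "theta \<theta>0 k > 0" .
  show "theta \<theta>0 k \<le> \<theta>0"
  proof (induction k)
    case (Suc k)
    then show ?case using *[OF pos[of k] refl] by simp
  qed simp
  show "(theta \<theta>0 (Suc k))\<^sup>2 = (1 - theta \<theta>0 (Suc k)) * (theta \<theta>0 k)\<^sup>2"
    using *[OF pos[of k] refl] by simp
qed

text \<open>
  The coefficient \<open>g\<^sub>k\<close> of \<open>z\<^sub>k\<close> in \<open>x\<^sub>k\<close>. At \<open>k = 0\<close> the value \<open>1\<close> expresses \<open>x\<^sub>0 = z\<^sub>0\<close>.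
\<close>
definition weight :: "real \<Rightarrow> nat \<Rightarrow> real" where
  "weight \<theta>0 k = (case k of 0 \<Rightarrow> 1 | Suc j \<Rightarrow> theta \<theta>0 j / \<theta>0)"

text \<open>
  The remaining part \<open>(1 - g\<^sub>k) R\<^sub>k\<close> of \<open>x\<^sub>k\<close> is updated with the coefficients \<open>mix\<close> of \<open>x\<^sub>k\<close> and
  \<open>keep\<close> of the old remaining part. They are found by eliminating \<open>z\<^sub>k\<close>, whose own coefficient in the
  update of \<open>x\<^sub>k\<close> is negative for \<open>\<theta>\<^sub>0 < 1\<close>, in favour of \<open>x\<^sub>k\<close> and \<open>R\<^sub>k\<close>; after that all
  coefficients are nonnegative.
\<close>
definition keep :: "real \<Rightarrow> nat \<Rightarrow> real" where
  "keep \<theta>0 k = (1 - \<theta>0) * weight \<theta>0 (Suc k) / weight \<theta>0 k"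

definition mix :: "real \<Rightarrow> nat \<Rightarrow> real" where
  "mix \<theta>0 k = 1 - theta \<theta>0 k - keep \<theta>0 k"

lemma weight_bounds:
  assumes "0 < \<theta>0" "\<theta>0 \<le> 1"
  shows "0 < weight \<theta>0 k" "weight \<theta>0 k \<le> 1"
  using theta_pos[OF assms] theta_le[OF assms] assms
  by (auto simp: weight_def split: nat.split)

text \<open>
  For \<open>k \<ge> 1\<close> and \<open>s = \<theta>\<^sub>k / \<theta>\<^sub>k\<^sub>-\<^sub>1\<close>, so that \<open>s\<^sup>2 = 1 - \<theta>\<^sub>k\<close>, the coefficient \<open>mix\<close> is
  \<open>s (s - (1 - \<theta>\<^sub>0))\<close>, and \<open>s \<ge> s\<^sup>2 = 1 - \<theta>\<^sub>k \<ge> 1 - \<theta>\<^sub>0\<close>.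
\<close>
lemma mix_nonneg:
  assumes "0 < \<theta>0" "\<theta>0 \<le> 1"
  shows "mix \<theta>0 k \<ge> 0" "keep \<theta>0 k \<ge> 0"
proof -
  show "keep \<theta>0 k \<ge> 0"
    using weight_bounds[OF assms] assms unfolding keep_def by (simp add: less_imp_le)
  show "mix \<theta>0 k \<ge> 0"
  proof (cases k)
    case 0
    then show ?thesis using assms by (simp add: mix_def keep_def weight_def)
  next
    case (Suc j)
    define s where "s = theta \<theta>0 (Suc j) / theta \<theta>0 j"
    have s0: "s > 0" using theta_pos[OF assms] by (simp add: s_def del: theta.simps)
    have s2: "s\<^sup>2 = 1 - theta \<theta>0 (Suc j)"
      using theta_Suc_sq[OF assms, of j] theta_pos[OF assms, of j]
      by (simp add: s_def power_divide del: theta.simps)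
    have "keep \<theta>0 k = (1 - \<theta>0) * s"
      using assms by (simp add: keep_def weight_def Suc s_def del: theta.simps)
    moreover have "s \<le> 1"
      using s2 theta_pos[OF assms, of "Suc j"] by (intro power2_le_imp_le[of s 1]) (auto simp del: theta.simps)
    then have "s * s \<le> s * 1" using s0 by (intro mult_left_mono) auto
    then have "s \<ge> 1 - \<theta>0" using s2 theta_le[OF assms, of "Suc j"] by (simp add: power2_eq_square del: theta.simps)
    then have "(1 - \<theta>0) * s \<le> s * s" using s0 by (intro mult_right_mono) auto
    ultimately show ?thesis using s2 by (simp add: mix_def Suc power2_eq_square del: theta.simps)
  qed
qed

lemma mix_plus_keep:
  assumes "0 < \<theta>0" "\<theta>0 \<le> 1"
  shows "mix \<theta>0 k + keep \<theta>0 k * (1 - weight \<theta>0 k) = 1 - weight \<theta>0 (Suc k)"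
    and "keep \<theta>0 k * weight \<theta>0 k = weight \<theta>0 (Suc k) - theta \<theta>0 k"
proof -
  have th: "theta \<theta>0 k = \<theta>0 * weight \<theta>0 (Suc k)" using assms by (simp add: weight_def)
  have kw: "keep \<theta>0 k * weight \<theta>0 k = (1 - \<theta>0) * weight \<theta>0 (Suc k)"
    using weight_bounds(1)[OF assms, of k] by (simp add: keep_def)
  show 1: "keep \<theta>0 k * weight \<theta>0 k = weight \<theta>0 (Suc k) - theta \<theta>0 k"
    unfolding th kw by (simp add: algebra_simps)
  then show "mix \<theta>0 k + keep \<theta>0 k * (1 - weight \<theta>0 k) = 1 - weight \<theta>0 (Suc k)"
    by (simp add: mix_def algebra_simps)
qed

text \<open>
  The factor of the objective gap in the potential: \<open>1 / \<theta>\<^sub>k\<^sub>-\<^sub>1\<^sup>2\<close>, continued to \<open>k = 0\<close> so that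
  \<open>level_eq\<close> holds there and the initial potential is \<open>\<Delta>(x\<^sub>0)\<close>.
\<close>
definition level :: "real \<Rightarrow> nat \<Rightarrow> real" where
  "level \<theta>0 k = (case k of 0 \<Rightarrow> (1 - \<theta>0) / \<theta>0\<^sup>2 | Suc j \<Rightarrow> 1 / (theta \<theta>0 j)\<^sup>2)"

lemma level_eq:
  assumes "0 < \<theta>0" "\<theta>0 \<le> 1"
  shows "level \<theta>0 k = (1 - theta \<theta>0 k) * level \<theta>0 (Suc k)"
proof (cases k)
  case 0
  then show ?thesis by (simp add: level_def)
next
  case (Suc j)
  then show ?thesis
    using theta_Suc_sq[OF assms, of j] theta_pos[OF assms, of j] theta_pos[OF assms, of "Suc j"]
    by (simp add: level_def field_simps del: theta.simps)
qed

section \<open>From coupled one-step inequalities to the rate\<close>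

text \<open>
  Among all pairs \<open>(D, G)\<close> with the two constraints, a combination \<open>A0 * G + D\<close> with \<open>A0 \<le> e\<close> is
  largest where growth is tight, \<open>G = m * D\<close>, and there \<open>D = Y\<close>. The proof exhibits the multipliers of
  this linear program.
\<close>
lemma combine_descent_and_growth:
  fixes A0 B D G e m Y :: real
  assumes "0 \<le> A0" "A0 \<le> e" "0 \<le> m" and DG: "D + e * G \<le> (1 + m * e) * Y" and G: "m * D \<le> G"
  shows "A0 * G + D \<le> (1 + A0 * m) * Y"
proof -
  have "(1 + m * e) * (A0 * G + D) = (1 + A0 * m) * (D + e * G) + (A0 - e) * (G - m * D)"
    by (simp add: algebra_simps)
  also have "\<dots> \<le> (1 + A0 * m) * ((1 + m * e) * Y) + 0"
    using assms by (intro add_mono mult_left_mono mult_nonpos_nonneg) auto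
  finally have "(1 + m * e) * (A0 * G + D) \<le> (1 + m * e) * ((1 + A0 * m) * Y)" by (simp add: algebra_simps)
  moreover have "1 + m * e > 0" using assms by (meson add_pos_nonneg mult_nonneg_nonneg order_trans zero_less_one)
  ultimately show ?thesis by (rule mult_left_le_imp_le)
qed

text \<open>
  One inductive step for the invariant \<open>(1 - g + g u) / (1 + u)\<close>. The new weight is \<open>s g\<close> and the new
  \<open>u\<close> is \<open>u / s\<^sup>2\<close>; the first summand on the left is the contribution of \<open>x\<^sub>k\<close>, the second that of
  \<open>R\<^sub>k\<close>.
\<close>
lemma remainder_step:
  fixes \<theta>0 s g u :: real
  assumes \<theta>0: "0 < \<theta>0" "\<theta>0 \<le> 1" and g: "0 < g" "g \<le> 1" and s: "0 < s" "s \<le> 1"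
    and s2: "s\<^sup>2 = 1 - \<theta>0 * (s * g)" and u: "u \<ge> 0"
  shows "(s\<^sup>2 - (1 - \<theta>0) * s) / (1 + u) + (1 - \<theta>0) * s * ((1 - g + g * u) / (1 + u))
    \<le> (1 - s * g + s * g * (u / s\<^sup>2)) / (1 + u / s\<^sup>2)"
proof -
  define h where "h = s * g"
  define c where "c = 1 - \<theta>0"
  define u' where "u' = u / s\<^sup>2"
  have h: "0 < h" "h \<le> 1" using g s by (auto simp: h_def mult_le_one)
  have c: "0 \<le> c" "c \<le> 1" "\<theta>0 = 1 - c" using \<theta>0 by (auto simp: c_def)
  have u': "u' \<ge> 0" "u = s\<^sup>2 * u'" using u s by (auto simp: u'_def)
  have s2h: "s\<^sup>2 = 1 - \<theta>0 * h" using s2 by (simp add: h_def)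
  \<comment> \<open>Both fractions on the left share the denominator; \<open>s\<^sup>2 = 1 - \<theta>0 h\<close> collapses the numerator.\<close>
  have num: "s\<^sup>2 - c * s + c * s * (1 - g + g * u) = 1 - h + c * h * u"
  proof -
    have "s\<^sup>2 - c * s + c * s * (1 - g + g * u) = s\<^sup>2 - c * h + c * h * u"
      by (simp add: h_def algebra_simps)
    also have "s\<^sup>2 - c * h = 1 - h" unfolding s2h c_def by (simp add: algebra_simps)
    finally show ?thesis .
  qed
  \<comment> \<open>The claim after clearing denominators and dividing by \<open>u'\<close>.\<close>
  have "(1 - h) * (1 - s\<^sup>2) + c * h * s\<^sup>2 + c * h * u \<le> h + h * u"
  proof -
    have "(1 - h) * \<theta>0 + c * s\<^sup>2 \<le> \<theta>0 + c"
    proof (rule add_mono)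
      show "(1 - h) * \<theta>0 \<le> \<theta>0" using h \<theta>0 by (simp add: algebra_simps)
      show "c * s\<^sup>2 \<le> c" using c s by (simp add: mult_left_le power_le_one)
    qed
    then have "h * ((1 - h) * \<theta>0 + c * s\<^sup>2) \<le> h * 1" using h c by (intro mult_left_mono) auto
    moreover have "(1 - h) * (1 - s\<^sup>2) + c * h * s\<^sup>2 = h * ((1 - h) * \<theta>0 + c * s\<^sup>2)"
    proof -
      have "1 - s\<^sup>2 = \<theta>0 * h" unfolding s2h by simp
      then show ?thesis by (simp only:) (simp add: algebra_simps)
    qed
    moreover have "c * h * u \<le> 1 * h * u" using c h u by (intro mult_right_mono) auto
    ultimately show ?thesis by linarith
  qed
  then have "u' * ((1 - h) * (1 - s\<^sup>2) + c * h * s\<^sup>2 + c * h * u) \<le> u' * (h + h * u)"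
    using u' by (intro mult_left_mono)
  then have "(1 - h + c * h * u) * (1 + u') \<le> (1 - h + h * u') * (1 + u)"
    using u'(2) by (simp add: algebra_simps)
  then have "(1 - h + c * h * u) / (1 + u) \<le> (1 - h + h * u') / (1 + u')"
    using frac_le_eq[of "1 + u" "1 + u'" "1 - h + c * h * u" "1 - h + h * u'"] u u'(1)
    by (smt (verit) divide_nonpos_pos mult_pos_pos)
  then show ?thesis
    unfolding h_def[symmetric] u'_def[symmetric] c_def[symmetric]
      times_divide_eq_right add_divide_distrib[symmetric] num .
qed

text \<open>
  Here \<open>G\<close> stands for the expected objective gap, and \<open>D\<close>, \<open>w\<close> for the expected squared distances
  of \<open>x\<^sub>k\<close>, \<open>z\<^sub>k\<close> from the minimizer, both divided by \<open>2 \<theta>\<^sub>0\<^sup>2\<close>; \<open>Pr\<close> is that of \<open>R\<^sub>k\<close>, weighted by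
  \<open>1 - g\<^sub>k\<close>. Once \<open>Pr k\<close> obeys its invariant \<open>T k\<close>, inserting \<open>descent\<close> into \<open>split\<close> brings the problem
  into the form of \<open>combine_descent_and_growth\<close>. That lemma is used with coefficient \<open>0\<close> inside the
  induction, where only \<open>D\<close> is needed, and with coefficient \<open>(1 - \<theta>0) / \<theta>0\<^sup>2\<close> for the final bound.
\<close>
lemma rate_of_coupled_recursion:
  fixes D G Pr w :: "nat \<Rightarrow> real" and m \<theta>0 \<Delta>0 :: real
  assumes \<theta>0: "0 < \<theta>0" "\<theta>0 \<le> 1" and m: "m \<ge> 0"  and \<Delta>0: "\<Delta>0 \<ge> 0"
    and descent: "\<And>k. level \<theta>0 k * G k + w k \<le> \<Delta>0"
    and growth: "\<And>k. m * D k \<le> G k"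
    and split: "\<And>k. D k \<le> weight \<theta>0 k * w k + Pr k"
    and Pr1: "Pr 1 \<le> 0"
    and Pr: "\<And>k. Pr (Suc k) \<le> mix \<theta>0 k * D k + keep \<theta>0 k * Pr k"
    and k: "k \<ge> 1"
  shows "(1 - \<theta>0) / \<theta>0\<^sup>2 * G k + D k
    \<le> (1 + (1 - \<theta>0) / \<theta>0\<^sup>2 * m) / (1 + m / (2 * (theta \<theta>0 (k - 1))\<^sup>2)) * \<Delta>0"
proof -
  note [simp del] = theta.simps
  define u where "u k = m / (2 * (theta \<theta>0 (k - 1))\<^sup>2)" for k
  define T where "T k = (1 - weight \<theta>0 k + weight \<theta>0 k * u k) / (1 + u k) * \<Delta>0" for k
  note th = theta_pos[OF \<theta>0] theta_le[OF \<theta>0]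
  note wt = weight_bounds[OF \<theta>0]
  have u0: "u k \<ge> 0" for k using m by (simp add: u_def)
  have bound: "A0 * G k + D k \<le> (1 + A0 * m) * (\<Delta>0 / (1 + u k))"
    if k: "k \<ge> 1" and A0: "0 \<le> A0" "A0 \<le> weight \<theta>0 k * level \<theta>0 k" and PT: "Pr k \<le> T k" for k A0
  proof (rule combine_descent_and_growth[where e = "weight \<theta>0 k * level \<theta>0 k"])
    have u2: "m * level \<theta>0 k = 2 * u k"
      using k by (cases k) (auto simp: level_def u_def)
    have "weight \<theta>0 k * w k \<le> weight \<theta>0 k * (\<Delta>0 - level \<theta>0 k * G k)"
      using descent[of k] wt(1)[of k] by (intro mult_left_mono) auto
    then have "D k + weight \<theta>0 k * level \<theta>0 k * G k \<le> weight \<theta>0 k * \<Delta>0 + T k"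
      using split[of k] PT by (simp add: algebra_simps)
    also have "\<dots> = (1 + weight \<theta>0 k * (2 * u k)) * (\<Delta>0 / (1 + u k))"
    proof -
      have "1 + u k \<noteq> 0" using u0[of k] by linarith
      then show ?thesis unfolding T_def by (simp add: field_simps)
    qed
    also have "weight \<theta>0 k * (2 * u k) = m * (weight \<theta>0 k * level \<theta>0 k)"
      unfolding u2[symmetric] by simp
    finally show "D k + weight \<theta>0 k * level \<theta>0 k * G k \<le> (1 + m * (weight \<theta>0 k * level \<theta>0 k)) * (\<Delta>0 / (1 + u k))" .
  qed (use that m growth in auto)
  have PT: "Pr (Suc j) \<le> T (Suc j)" for j
  proof (induction j)
    case 0
    have "T 1 = u 1 / (1 + u 1) * \<Delta>0" using \<theta>0 by (simp add: T_def weight_def theta.simps)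
    moreover have "u 1 / (1 + u 1) * \<Delta>0 \<ge> 0" using u0[of 1] \<Delta>0 by simp
    ultimately show ?case using Pr1 by simp
  next
    case (Suc j)
    let ?k = "Suc j"
    define s where "s = theta \<theta>0 ?k / theta \<theta>0 j"
    have s0: "s > 0" using th by (simp add: s_def)
    have s2: "s\<^sup>2 = 1 - theta \<theta>0 ?k"
      using theta_Suc_sq[OF \<theta>0, of j] th(1)[of j] by (simp add: s_def power_divide)
    have s1: "s \<le> 1"
      using s2 th(1)[of ?k] by (intro power2_le_imp_le[of s 1]) auto
    have keep: "keep \<theta>0 ?k = (1 - \<theta>0) * s"
      using \<theta>0 by (simp add: keep_def weight_def s_def)
    have mix: "mix \<theta>0 ?k = s\<^sup>2 - (1 - \<theta>0) * s" by (simp add: mix_def keep s2)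
    have w': "weight \<theta>0 (Suc ?k) = s * weight \<theta>0 ?k"
      using th(1)[of j] by (simp add: weight_def s_def)
    have sw: "s\<^sup>2 = 1 - \<theta>0 * (s * weight \<theta>0 ?k)"
      unfolding w'[symmetric] using s2 \<theta>0 by (simp add: weight_def)
    have u': "u (Suc ?k) = u ?k / s\<^sup>2"
      using th(1)[of j] th(1)[of ?k] by (simp add: u_def s_def power_divide)
    have "level \<theta>0 ?k \<ge> 0" by (simp add: level_def)
    then have "D ?k \<le> \<Delta>0 / (1 + u ?k)"
      using bound[of ?k 0] Suc wt(1)[of ?k] by simp
    then have "Pr (Suc ?k) \<le> mix \<theta>0 ?k * (\<Delta>0 / (1 + u ?k)) + keep \<theta>0 ?k * T ?k"
      using Pr[of ?k] Suc mix_nonneg[OF \<theta>0, of ?k]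
      by (smt (verit) mult_left_mono)
    also have "\<dots> = ((s\<^sup>2 - (1 - \<theta>0) * s) / (1 + u ?k) + (1 - \<theta>0) * s *
        ((1 - weight \<theta>0 ?k + weight \<theta>0 ?k * u ?k) / (1 + u ?k))) * \<Delta>0"
      unfolding T_def mix keep times_divide_eq_right times_divide_eq_left distrib_right mult.assoc ..
    also have "\<dots> \<le> T (Suc ?k)"
      unfolding T_def w' u'
      by (intro mult_right_mono remainder_step \<theta>0 wt s0 s1 sw u0 \<Delta>0)
    finally show ?case .
  qed
  obtain j where j: "k = Suc j" using k by (cases k) auto
  have "(1 - \<theta>0) / \<theta>0\<^sup>2 * G k + D k \<le> (1 + (1 - \<theta>0) / \<theta>0\<^sup>2 * m) * (\<Delta>0 / (1 + u k))"
  proof (rule bound[OF k])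
    show "0 \<le> (1 - \<theta>0) / \<theta>0\<^sup>2" using \<theta>0 by simp
    have "(1 - \<theta>0) / \<theta>0\<^sup>2 \<le> 1 / \<theta>0\<^sup>2" using \<theta>0 by (intro divide_right_mono) auto
    also have "\<dots> \<le> 1 / (\<theta>0 * theta \<theta>0 j)"
      unfolding power2_eq_square using th[of j] \<theta>0 by (intro divide_left_mono mult_left_mono) auto
    also have "\<dots> = weight \<theta>0 k * level \<theta>0 k"
      using th(1)[of j] by (simp add: j weight_def level_def power2_eq_square)
    finally show "(1 - \<theta>0) / \<theta>0\<^sup>2 \<le> weight \<theta>0 k * level \<theta>0 k" .
    show "Pr k \<le> T k" using PT j by simp
  qed
  then show ?thesis by (simp add: u_def)
qed

section \<open>Averaging over independent draws from a finite set\<close>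

text \<open>
  A functional of the draws that reads at most the first \<open>k\<close> of them. For draws from a finite type it
  takes finitely many values, which settles measurability and integrability.
\<close>
definition determined :: "nat \<Rightarrow> ((nat \<Rightarrow> 'a) \<Rightarrow> 'b) \<Rightarrow> bool" where
  "determined k \<Phi> \<longleftrightarrow> (\<forall>s s'. (\<forall>j<k. s j = s' j) \<longrightarrow> \<Phi> s = \<Phi> s')"

lemma determinedD: "determined k \<Phi> \<Longrightarrow> (\<And>j. j < k \<Longrightarrow> s j = s' j) \<Longrightarrow> \<Phi> s = \<Phi> s'"
  by (auto simp: determined_def)

context prob_space
begin

context
  fixes S :: "nat \<Rightarrow> 'a \<Rightarrow> 'b::finite"
  assumes indep: "indep_vars (\<lambda>_. count_space UNIV) S UNIV"
begin

lemma measurable_draw: "S j \<in> measurable M (count_space UNIV)"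
  using indep by (auto simp: indep_vars_def)

lemma restrict_measurable:
  "h \<in> measurable (Pi\<^sub>M {..<k} (\<lambda>_. count_space (UNIV :: 'b set))) borel" for h :: "(nat \<Rightarrow> 'b) \<Rightarrow> real"
  by (simp add: count_space_PiM_finite)

lemma determined_restrict:
  assumes "determined k \<Phi>"
  shows "\<Phi> (\<lambda>j. S j \<omega>) = \<Phi> (restrict (\<lambda>j. S j \<omega>) {..<k})"
  using assms by (rule determinedD) auto

lemma integrable_determined:
  fixes \<Phi> :: "(nat \<Rightarrow> 'b) \<Rightarrow> real"
  assumes d: "determined k \<Phi>"
  shows "integrable M (\<lambda>\<omega>. \<Phi> (\<lambda>j. S j \<omega>))"
proof -
  have fin: "finite (({..<k} \<rightarrow>\<^sub>E UNIV) :: (nat \<Rightarrow> 'b) set)"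
    by (intro finite_PiE) auto
  have "(\<lambda>\<omega>. restrict (\<lambda>j. S j \<omega>) {..<k}) \<in> measurable M (Pi\<^sub>M {..<k} (\<lambda>_. count_space UNIV))"
    by (intro measurable_restrict measurable_draw)
  then have "(\<lambda>\<omega>. \<Phi> (restrict (\<lambda>j. S j \<omega>) {..<k})) \<in> borel_measurable M"
    by (rule measurable_compose[OF _ restrict_measurable])
  moreover have "norm (\<Phi> (restrict (\<lambda>j. S j \<omega>) {..<k})) \<le> (\<Sum>s\<in>{..<k} \<rightarrow>\<^sub>E UNIV. \<bar>\<Phi> s\<bar>)" for \<omega>
    unfolding real_norm_def by (rule member_le_sum[where f = "\<lambda>s. \<bar>\<Phi> s\<bar>"]) (auto simp: fin)
  ultimately show ?thesis
    unfolding determined_restrict[OF d] by (intro integrable_const_bound) auto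
qed

lemma prob_draw:
  assumes law: "distr M (count_space UNIV) (S j) = measure_pmf P"
  shows "expectation (\<lambda>\<omega>. indicat_real {t} (S j \<omega>)) = pmf P t"
proof -
  have "expectation (\<lambda>\<omega>. indicat_real {t} (S j \<omega>)) = (\<integral>s. indicat_real {t} s \<partial>distr M (count_space UNIV) (S j))"
    by (subst integral_distr[OF measurable_draw]) auto
  also have "\<dots> = pmf P t" unfolding law by (simp add: pmf.rep_eq)
  finally show ?thesis .
qed

text \<open>
  The tower property for a functional of \<open>Suc k\<close> draws. Splitting by the value \<open>t\<close> of the last draw
  turns the expectation into a finite sum of products of an indicator of that draw with a functional
  of the earlier ones, and independence factorizes each product.
\<close>
lemma expectation_last_draw:
  fixes \<Phi> :: "(nat \<Rightarrow> 'b) \<Rightarrow> real"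
  assumes law: "distr M (count_space UNIV) (S k) = measure_pmf P"
    and d: "determined (Suc k) \<Phi>"
  shows "expectation (\<lambda>\<omega>. \<Phi> (\<lambda>j. S j \<omega>))
    = expectation (\<lambda>\<omega>. measure_pmf.expectation P (\<lambda>t. \<Phi> ((\<lambda>j. S j \<omega>)(k := t))))"
proof -
  have det: "determined k (\<lambda>s. \<Phi> (s(k := t)))" for t
    using d by (auto simp: determined_def less_Suc_eq)
  have ind: "determined (Suc k) (\<lambda>s. indicat_real {t} (s k))" for t
    by (auto simp: determined_def)
  have "\<Phi> s = (\<Sum>t\<in>UNIV. indicat_real {t} (s k) * \<Phi> (s(k := t)))" for s
    by (subst sum.remove[of _ "s k"]) (auto intro!: sum.neutral)
  then have "expectation (\<lambda>\<omega>. \<Phi> (\<lambda>j. S j \<omega>))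
      = expectation (\<lambda>\<omega>. \<Sum>t\<in>UNIV. indicat_real {t} (S k \<omega>) * \<Phi> ((\<lambda>j. S j \<omega>)(k := t)))"
    by (metis (no_types))
  also have "\<dots> = (\<Sum>t\<in>UNIV. expectation (\<lambda>\<omega>. indicat_real {t} (S k \<omega>) * \<Phi> ((\<lambda>j. S j \<omega>)(k := t))))"
  proof (rule Bochner_Integration.integral_sum)
    fix t
    have "determined (Suc k) (\<lambda>s. indicat_real {t} (s k) * \<Phi> (s(k := t)))"
      using d by (auto simp: determined_def less_Suc_eq)
    then show "integrable M (\<lambda>\<omega>. indicat_real {t} (S k \<omega>) * \<Phi> ((\<lambda>j. S j \<omega>)(k := t)))"
      using integrable_determined[of "Suc k" "\<lambda>s. indicat_real {t} (s k) * \<Phi> (s(k := t))"] by simp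
  qed
  also have "\<dots> = (\<Sum>t\<in>UNIV. pmf P t * expectation (\<lambda>\<omega>. \<Phi> ((\<lambda>j. S j \<omega>)(k := t))))"
  proof (rule sum.cong)
    fix t
    let ?A = "\<lambda>\<omega>. restrict (\<lambda>j. S j \<omega>) {..<k}" and ?B = "\<lambda>\<omega>. restrict (\<lambda>j. S j \<omega>) {k}"
    have "indep_var (Pi\<^sub>M {k} (\<lambda>_. count_space UNIV)) ?B (Pi\<^sub>M {..<k} (\<lambda>_. count_space UNIV)) ?A"
      by (rule indep_var_restrict[OF indep]) auto
    then have "indep_var borel ((\<lambda>s. indicat_real {t} (s k)) \<circ> ?B) borel ((\<lambda>s. \<Phi> (s(k := t))) \<circ> ?A)"
    proof (rule indep_var_compose)
      show "(\<lambda>s. indicat_real {t} (s k)) \<in> measurable (Pi\<^sub>M {k} (\<lambda>_. count_space UNIV)) borel"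
        by (simp add: count_space_PiM_finite)
      show "(\<lambda>s. \<Phi> (s(k := t))) \<in> measurable (Pi\<^sub>M {..<k} (\<lambda>_. count_space UNIV)) borel"
        by (rule restrict_measurable)
    qed
    moreover have "((\<lambda>s. indicat_real {t} (s k)) \<circ> ?B) = (\<lambda>\<omega>. indicat_real {t} (S k \<omega>))"
      by (auto simp: fun_eq_iff)
    moreover have "((\<lambda>s. \<Phi> (s(k := t))) \<circ> ?A) = (\<lambda>\<omega>. \<Phi> ((\<lambda>j. S j \<omega>)(k := t)))"
      using determined_restrict[OF det] by (auto simp: fun_eq_iff)
    ultimately have "indep_var borel (\<lambda>\<omega>. indicat_real {t} (S k \<omega>)) borel (\<lambda>\<omega>. \<Phi> ((\<lambda>j. S j \<omega>)(k := t)))"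
      by simp
    then have "expectation (\<lambda>\<omega>. indicat_real {t} (S k \<omega>) * \<Phi> ((\<lambda>j. S j \<omega>)(k := t)))
        = expectation (\<lambda>\<omega>. indicat_real {t} (S k \<omega>)) * expectation (\<lambda>\<omega>. \<Phi> ((\<lambda>j. S j \<omega>)(k := t)))"
      using integrable_determined[OF ind] integrable_determined[OF det]
      by (rule indep_var_lebesgue_integral)
    then show "expectation (\<lambda>\<omega>. indicat_real {t} (S k \<omega>) * \<Phi> ((\<lambda>j. S j \<omega>)(k := t)))
        = pmf P t * expectation (\<lambda>\<omega>. \<Phi> ((\<lambda>j. S j \<omega>)(k := t)))"
      by (simp only: prob_draw[OF law])
  qed simp
  also have "\<dots> = expectation (\<lambda>\<omega>. \<Sum>t\<in>UNIV. pmf P t * \<Phi> ((\<lambda>j. S j \<omega>)(k := t)))"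
    using integrable_determined[OF det] by (subst Bochner_Integration.integral_sum) auto
  also have "\<dots> = expectation (\<lambda>\<omega>. measure_pmf.expectation P (\<lambda>t. \<Phi> ((\<lambda>j. S j \<omega>)(k := t))))"
    by (subst integral_measure_pmf[where A = UNIV]) (auto simp: mult.commute)
  finally show ?thesis .
qed

end

end

section \<open>One randomized proximal step\<close>

lemma mean_size_eq_sum_prob:
  "mean_size P = (\<Sum>i\<in>UNIV. measure_pmf.prob P {S. i \<in> S})"
proof -
  have "real (card S) = (\<Sum>i\<in>UNIV. indicat_real {S. i \<in> S} S)" for S :: "'a set"
    by (simp add: indicator_def sum.If_cases)
  then have "mean_size P = measure_pmf.expectation P (\<lambda>S. \<Sum>i\<in>UNIV. indicat_real {S. i \<in> S} S)"
    by (simp add: mean_size_def)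
  also have "\<dots> = (\<Sum>i\<in>UNIV. measure_pmf.expectation P (indicat_real {S. i \<in> S}))"
    by (intro Bochner_Integration.integral_sum integrable_measure_pmf_finite) simp
  finally show ?thesis by simp
qed

definition select :: "'n::finite set \<Rightarrow> real ^ 'n \<Rightarrow> real ^ 'n \<Rightarrow> real ^ 'n" where
  "select S a b = (\<chi> i. if i \<in> S then a $ i else b $ i)"

locale coordinate_problem =
  fixes f :: "real ^ 'n::finite \<Rightarrow> real"
    and gradf :: "real ^ 'n \<Rightarrow> real ^ 'n"
    and \<psi> :: "'n \<Rightarrow> real \<Rightarrow> ereal"
    and v :: "real ^ 'n"
    and P :: "'n set pmf"
    and \<tau> \<theta>0 :: real
  assumes f_convex: "convex_on UNIV f"
    and f_grad: "\<And>x. GDERIV f x :> gradf x"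
    and psi: "\<And>i. closed_proper_convex (\<psi> i)"
    and v_pos: "\<And>i. v $ i > 0"
    and uniform: "uniform_sampling P"
    and tau_def: "\<tau> = mean_size P"
    and tau_pos: "\<tau> > 0"
    and eso: "ESO f gradf P v"
    and theta0_def: "\<theta>0 = \<tau> / real CARD('n)"
begin

abbreviation Q :: "real ^ 'n \<Rightarrow> real" where
  "Q x \<equiv> (wnorm v x)\<^sup>2"

definition Psi :: "real ^ 'n \<Rightarrow> real" where
  "Psi x = (\<Sum>i\<in>UNIV. real_of_ereal (\<psi> i (x $ i)))"

definition psi_dom :: "(real ^ 'n) set" where
  "psi_dom = {x. \<forall>i. x $ i \<in> edom (\<psi> i)}"

text \<open>
  The common inclusion probability, summed over the \<open>n\<close> coordinates, is the mean size \<open>\<tau>\<close>.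
\<close>
lemma prob_selected: "measure_pmf.prob P {S. i \<in> S} = \<theta>0"
proof -
  have "mean_size P = (\<Sum>j\<in>(UNIV::'n set). measure_pmf.prob P {S. i \<in> S})"
    unfolding mean_size_eq_sum_prob using uniform by (intro sum.cong) (auto simp: uniform_sampling_def)
  then show ?thesis by (simp add: theta0_def tau_def)
qed

lemma theta0_bounds: "0 < \<theta>0" "\<theta>0 \<le> 1"
  proof -
  show "0 < \<theta>0" using tau_pos by (simp add: theta0_def)
  show "\<theta>0 \<le> 1" unfolding prob_selected[of undefined, symmetric] by (rule measure_pmf.prob_le_1)
qed

lemma integrable_sampling [simp]: "integrable (measure_pmf P) (h :: 'n set \<Rightarrow> real)"
  by (rule integrable_measure_pmf_finite) simp

lemma expectation_select:
  "measure_pmf.expectation P (\<lambda>S. \<Sum>i\<in>UNIV. q i (select S a b $ i))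
    = \<theta>0 * (\<Sum>i\<in>UNIV. q i (a $ i)) + (1 - \<theta>0) * (\<Sum>i\<in>UNIV. q i (b $ i))"
    for q :: "'n \<Rightarrow> real \<Rightarrow> real"
proof -
  have "measure_pmf.expectation P (\<lambda>S. \<Sum>i\<in>UNIV. q i (select S a b $ i))
      = (\<Sum>i\<in>UNIV. measure_pmf.expectation P (\<lambda>S. q i (select S a b $ i)))"
    by (rule Bochner_Integration.integral_sum) simp
  also have "\<dots> = (\<Sum>i\<in>UNIV. \<theta>0 * q i (a $ i) + (1 - \<theta>0) * q i (b $ i))"
  proof (rule sum.cong)
    fix i
    have "q i (select S a b $ i) = q i (b $ i) + (q i (a $ i) - q i (b $ i)) * indicat_real {S. i \<in> S} S" for S
      by (simp add: select_def)
    then have "measure_pmf.expectation P (\<lambda>S. q i (select S a b $ i))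
        = q i (b $ i) + (q i (a $ i) - q i (b $ i)) * \<theta>0"
      by (simp add: prob_selected)
    then show "measure_pmf.expectation P (\<lambda>S. q i (select S a b $ i))
        = \<theta>0 * q i (a $ i) + (1 - \<theta>0) * q i (b $ i)"
      by (simp add: algebra_simps)
  qed simp
  finally show ?thesis by (simp add: sum.distrib sum_distrib_left)
qed

lemma expectation_Psi_select:
  "measure_pmf.expectation P (\<lambda>S. Psi (select S a b)) = \<theta>0 * Psi a + (1 - \<theta>0) * Psi b"
  unfolding Psi_def by (rule expectation_select)

lemma expectation_Q_select:
  "measure_pmf.expectation P (\<lambda>S. Q (select S a b - w)) = \<theta>0 * Q (a - w) + (1 - \<theta>0) * Q (b - w)"
  using expectation_select[of "\<lambda>i u. v $ i * (u - w $ i)\<^sup>2" a b] by (simp add: wnorm_sq[OF v_pos])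

lemma Psi_convex: "convex_on psi_dom Psi"
proof (rule convex_onI)
  note cv = closed_proper_convex_convex_on[OF psi]
  show "convex psi_dom"
    using cv by (auto simp: psi_dom_def convex_on_def convex_def)
  fix t :: real and x y assume t: "0 < t" "t < 1" and xy: "x \<in> psi_dom" "y \<in> psi_dom"
  show "Psi ((1 - t) *\<^sub>R x + t *\<^sub>R y) \<le> (1 - t) * Psi x + t * Psi y"
    unfolding Psi_def sum_distrib_left sum.distrib[symmetric]
  proof (rule sum_mono)
    fix i
    show "real_of_ereal (\<psi> i (((1 - t) *\<^sub>R x + t *\<^sub>R y) $ i))
        \<le> (1 - t) * real_of_ereal (\<psi> i (x $ i)) + t * real_of_ereal (\<psi> i (y $ i))"
      using convex_onD[OF cv[of i], of t "x $ i" "y $ i"] t xy by (simp add: psi_dom_def)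
  qed
qed

text \<open>
  The proximal update of all coordinates at once, of which an iteration reveals the drawn ones.
  It does not depend on the draw, and this is what makes the conditional expectation of a
  separable function of the new point an affine combination.
\<close>
definition full_step :: "real \<Rightarrow> real ^ 'n \<Rightarrow> real ^ 'n \<Rightarrow> real ^ 'n" where
  "full_step \<theta> y z = (\<chi> i. arg_min (\<lambda>u. ereal (gradf y $ i * (u - y $ i)
     + \<theta> * real CARD('n) * v $ i / (2 * \<tau>) * \<bar>u - z $ i\<bar>\<^sup>2) + \<psi> i u) (\<lambda>_. True))"

lemma prox_coefficient:
  "\<theta> * real CARD('n) * v $ i / (2 * \<tau>) = \<theta> / (2 * \<theta>0) * v $ i"
  using tau_pos by (simp add: theta0_def)

lemma full_step_dom:
  assumes "\<theta> > 0" shows "full_step \<theta> y z \<in> psi_dom"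
proof -
  have "\<theta> * real CARD('n) * v $ i / (2 * \<tau>) > 0" for i
    unfolding prox_coefficient using assms theta0_bounds v_pos by simp
  then have "full_step \<theta> y z $ i \<in> edom (\<psi> i)" for i
    unfolding full_step_def vec_lambda_beta by (rule prox_in_edom[OF psi])
  then show ?thesis by (simp add: psi_dom_def)
qed

lemma full_step_three_point:
  fixes y z :: "real ^ 'n"
  assumes "\<theta> > 0" and w: "w \<in> psi_dom"
  defines "p \<equiv> full_step \<theta> y z"
  shows "gradf y \<bullet> (p - y) + \<theta> / (2 * \<theta>0) * Q (p - z) + Psi p + \<theta> / (2 * \<theta>0) * Q (w - p)
    \<le> gradf y \<bullet> (w - y) + \<theta> / (2 * \<theta>0) * Q (w - z) + Psi w"
proof -
  have c: "\<theta> * real CARD('n) * v $ i / (2 * \<tau>) > 0" for i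
    unfolding prox_coefficient using assms theta0_bounds v_pos by simp
  have "gradf y $ i * (p $ i - y $ i) + \<theta> / (2 * \<theta>0) * v $ i * (p $ i - z $ i)\<^sup>2
        + real_of_ereal (\<psi> i (p $ i)) + \<theta> / (2 * \<theta>0) * v $ i * (w $ i - p $ i)\<^sup>2
      \<le> gradf y $ i * (w $ i - y $ i) + \<theta> / (2 * \<theta>0) * v $ i * (w $ i - z $ i)\<^sup>2
        + real_of_ereal (\<psi> i (w $ i))" for i
    using prox_ineq[where b = "gradf y $ i" and y = "y $ i" and z = "z $ i", OF psi[of i] c[of i], of "w $ i"] w
    unfolding p_def full_step_def vec_lambda_beta prox_coefficient by (simp only: psi_dom_def mem_Collect_eq)
  then have "(\<Sum>i\<in>UNIV. gradf y $ i * (p $ i - y $ i) + \<theta> / (2 * \<theta>0) * v $ i * (p $ i - z $ i)\<^sup>2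
        + real_of_ereal (\<psi> i (p $ i)) + \<theta> / (2 * \<theta>0) * v $ i * (w $ i - p $ i)\<^sup>2)
      \<le> (\<Sum>i\<in>UNIV. gradf y $ i * (w $ i - y $ i) + \<theta> / (2 * \<theta>0) * v $ i * (w $ i - z $ i)\<^sup>2
        + real_of_ereal (\<psi> i (w $ i)))"
    by (intro sum_mono)
  then show ?thesis
    by (simp add: sum.distrib inner_vec_def wnorm_sq[OF v_pos] Psi_def sum_distrib_left mult.assoc)
qed

text \<open>
  Here \<open>p\<close> is a surrogate for \<open>\<Psi>(x)\<close>. By uniformity of the sampling, the surrogate and the squared
  distance average to values at the full step \<open>zt\<close> and at \<open>z\<close>. The smooth part is bounded by the ESO
  inequality with \<open>h = (\<theta> / \<theta>0) (zt - z)\<close>, whose quadratic term is then exactly the proximal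
  quadratic, so that the three-point inequality at the comparison point \<open>w\<close> applies. What remains of
  the gradient terms is \<open>(1 - \<theta>) \<langle>\<nabla>f(y), x - y\<rangle> + \<theta> \<langle>\<nabla>f(y), w - y\<rangle>\<close>, by the choice of \<open>y\<close>.
\<close>
lemma one_step:
  fixes x z :: "real ^ 'n"
  assumes \<theta>: "0 < \<theta>" "\<theta> \<le> 1" and w: "w \<in> psi_dom"
  defines "y \<equiv> (1 - \<theta>) *\<^sub>R x + \<theta> *\<^sub>R z"
  defines "zt \<equiv> full_step \<theta> y z"
  shows "measure_pmf.expectation P (\<lambda>S.
        f (y + (\<theta> / \<theta>0) *\<^sub>R (select S zt z - z))
        + ((1 - \<theta>) * p + \<theta> * Psi z + \<theta> / \<theta>0 * (Psi (select S zt z) - Psi z))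
        + \<theta>\<^sup>2 / (2 * \<theta>0\<^sup>2) * Q (select S zt z - w))
    \<le> (1 - \<theta>) * (f x + p) + \<theta> * (f w + Psi w) + \<theta>\<^sup>2 / (2 * \<theta>0\<^sup>2) * Q (z - w)"
    (is "?E \<le> _")
proof -
  let ?Ef = "measure_pmf.expectation P (\<lambda>S. f (y + (\<theta> / \<theta>0) *\<^sub>R (select S zt z - z)))"
  let ?g = "gradf y"
  have Q_scale: "Q (c *\<^sub>R h) = c\<^sup>2 * Q h" for c h
    unfolding wnorm_sq[OF v_pos] by (simp add: sum_distrib_left power_mult_distrib mult.left_commute)
  have Q_sym: "Q (a - b) = Q (b - a)" for a b
    unfolding wnorm_sq[OF v_pos] by (simp add: power2_commute)
  have "?Ef \<le> f y + \<theta>0 * (?g \<bullet> ((\<theta> / \<theta>0) *\<^sub>R (zt - z)) + 1 / 2 * Q ((\<theta> / \<theta>0) *\<^sub>R (zt - z)))"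
  proof -
    have "(\<theta> / \<theta>0) *\<^sub>R (select S zt z - z) = restrict_vec S ((\<theta> / \<theta>0) *\<^sub>R (zt - z))" for S
      by (simp add: select_def restrict_vec_def vec_eq_iff)
    then show ?thesis
      using eso unfolding ESO_def theta0_def tau_def by presburger
  qed
  also have "\<dots> = f y + \<theta> * (?g \<bullet> (zt - z)) + \<theta> * (\<theta> / (2 * \<theta>0) * Q (zt - z))"
    unfolding Q_scale inner_scaleR_right using theta0_bounds by (simp add: field_simps power2_eq_square)
  finally have Ef: "?Ef \<le> \<dots>" .
  have E: "?E = ?Ef + ((1 - \<theta>) * p + \<theta> * Psi zt)
      + \<theta>\<^sup>2 / (2 * \<theta>0\<^sup>2) * (\<theta>0 * Q (zt - w) + (1 - \<theta>0) * Q (z - w))"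
  proof -
    have "?E = ?Ef + ((1 - \<theta>) * p + \<theta> * Psi z + \<theta> / \<theta>0 * (\<theta>0 * Psi zt + (1 - \<theta>0) * Psi z - Psi z))
      + \<theta>\<^sup>2 / (2 * \<theta>0\<^sup>2) * (\<theta>0 * Q (zt - w) + (1 - \<theta>0) * Q (z - w))"
      by (simp add: expectation_Psi_select expectation_Q_select)
    then show ?thesis using theta0_bounds by (simp add: field_simps)
  qed
  have tp: "\<theta> * (?g \<bullet> (zt - y) + \<theta> / (2 * \<theta>0) * Q (zt - z) + Psi zt + \<theta> / (2 * \<theta>0) * Q (w - zt))
    \<le> \<theta> * (?g \<bullet> (w - y) + \<theta> / (2 * \<theta>0) * Q (w - z) + Psi w)"
    using full_step_three_point[OF \<theta>(1) w, of y z] \<theta> unfolding zt_def by (intro mult_left_mono) auto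
  have grads: "(1 - \<theta>) * (f y + ?g \<bullet> (x - y)) + \<theta> * (f y + ?g \<bullet> (w - y)) \<le> (1 - \<theta>) * f x + \<theta> * f w"
    using \<theta> by (intro add_mono mult_left_mono convex_ge_tangent f_convex f_grad) auto
  have "\<theta> *\<^sub>R (y - z) = (1 - \<theta>) *\<^sub>R (x - y)"
    by (simp add: y_def algebra_simps)
  then have yz: "\<theta> * (?g \<bullet> (y - z)) = (1 - \<theta>) * (?g \<bullet> (x - y))"
    by (metis inner_scaleR_right)
  have inner_split: "?g \<bullet> (zt - z) = ?g \<bullet> (zt - y) + ?g \<bullet> (y - z)"
    by (simp add: inner_diff_right)
  define c where "c = \<theta> * (\<theta> / (2 * \<theta>0))"
  have coef: "\<theta>\<^sup>2 / (2 * \<theta>0\<^sup>2) * (\<theta>0 * X + (1 - \<theta>0) * Y) = c * X - c * Y + \<theta>\<^sup>2 / (2 * \<theta>0\<^sup>2) * Y" for X Y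
    using theta0_bounds unfolding c_def by (simp add: field_simps power2_eq_square)
  \<comment> \<open>Move the base point of the linear term from \<open>z\<close> to \<open>y\<close>; the difference is absorbed by
  \<open>\<theta> (y - z) = (1 - \<theta>) (x - y)\<close>.\<close>
  have "?E \<le> f y + \<theta> * (?g \<bullet> (zt - y)) + (1 - \<theta>) * (?g \<bullet> (x - y)) + c * Q (zt - z)
      + ((1 - \<theta>) * p + \<theta> * Psi zt) + (c * Q (zt - w) - c * Q (z - w) + \<theta>\<^sup>2 / (2 * \<theta>0\<^sup>2) * Q (z - w))"
    using Ef yz unfolding E coef inner_split c_def by (simp add: distrib_left mult.assoc)
  moreover have "\<theta> * (?g \<bullet> (zt - y)) + c * Q (zt - z) + \<theta> * Psi zt + c * Q (zt - w)
      \<le> \<theta> * (?g \<bullet> (w - y)) + c * Q (z - w) + \<theta> * Psi w"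
    using tp unfolding c_def Q_sym[of w] by (simp add: distrib_left mult.assoc)
  moreover have "f y + (1 - \<theta>) * (?g \<bullet> (x - y)) + \<theta> * (?g \<bullet> (w - y)) \<le> (1 - \<theta>) * f x + \<theta> * f w"
    using grads by (simp add: algebra_simps)
  ultimately show ?thesis by (simp add: distrib_left)
qed

end

section \<open>The run of the algorithm\<close>

text \<open>
  A run started at \<open>x0\<close> and compared with a point \<open>xs\<close> of quadratic growth; the latter is
  the only form in which strong convexity is used. In what follows \<open>s\<close> is the sequence of drawn subsets.
\<close>
locale approx_run = coordinate_problem f gradf \<psi> v P \<tau> \<theta>0
  for f :: "real ^ 'n::finite \<Rightarrow> real" and gradf \<psi> v P \<tau> \<theta>0 +
  fixes x0 xs :: "real ^ 'n" and \<mu> :: real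
  assumes x0: "x0 \<in> psi_dom" and xs: "xs \<in> psi_dom" and mu: "\<mu> \<ge> 0"
    and growth: "\<And>x. x \<in> psi_dom \<Longrightarrow> f xs + Psi xs + \<mu> / 2 * (wnorm v (x - xs))\<^sup>2 \<le> f x + Psi x"
begin

abbreviation \<theta> :: "nat \<Rightarrow> real" where
  "\<theta> k \<equiv> theta \<theta>0 k"

definition X :: "(nat \<Rightarrow> 'n set) \<Rightarrow> nat \<Rightarrow> real ^ 'n" where
  "X s k = fst (approx gradf \<psi> v \<tau> x0 s k)"

definition Z :: "(nat \<Rightarrow> 'n set) \<Rightarrow> nat \<Rightarrow> real ^ 'n" where
  "Z s k = snd (approx gradf \<psi> v \<tau> x0 s k)"

definition Y :: "(nat \<Rightarrow> 'n set) \<Rightarrow> nat \<Rightarrow> real ^ 'n" where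
  "Y s k = (1 - \<theta> k) *\<^sub>R X s k + \<theta> k *\<^sub>R Z s k"

text \<open>
  The recursion of \<open>x\<^sub>k\<close> with the vectors \<open>z\<^sub>k\<close> replaced by the numbers \<open>\<Psi>(z\<^sub>k)\<close>. Being affine
  in \<open>\<Psi>(z\<^sub>k\<^sub>+\<^sub>1)\<close>, it has a computable conditional expectation, unlike \<open>\<Psi>(x\<^sub>k\<^sub>+\<^sub>1)\<close>.
\<close>
primrec Psihat :: "(nat \<Rightarrow> 'n set) \<Rightarrow> nat \<Rightarrow> real" where
  "Psihat s 0 = Psi x0"
| "Psihat s (Suc k) = (1 - \<theta> k) * Psihat s k + \<theta> k * Psi (Z s k)
     + \<theta> k / \<theta>0 * (Psi (Z s (Suc k)) - Psi (Z s k))"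

text \<open>
  The normalized remaining part of \<open>x\<^sub>k\<close>. When \<open>g\<^sub>k = 1\<close>, as at \<open>k = 0\<close> and \<open>k = 1\<close>, nothing remains;
  the value \<open>x0\<close> then only keeps \<open>R\<close> inside the domain.
\<close>
primrec R :: "(nat \<Rightarrow> 'n set) \<Rightarrow> nat \<Rightarrow> real ^ 'n" where
  "R s 0 = x0"
| "R s (Suc k) = (if weight \<theta>0 (Suc k) = 1 then x0 else
     (1 / (1 - weight \<theta>0 (Suc k))) *\<^sub>R (mix \<theta>0 k *\<^sub>R X s k + (keep \<theta>0 k * (1 - weight \<theta>0 k)) *\<^sub>R R s k))"

lemma XZ_0 [simp]: "X s 0 = x0" "Z s 0 = x0"
  by (simp_all add: X_def Z_def)

lemma approx_Suc:
  fixes s k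
  defines "z' \<equiv> select (s k) (full_step (\<theta> k) (Y s k) (Z s k)) (Z s k)"
  shows "approx gradf \<psi> v \<tau> x0 s (Suc k) = (Y s k + (\<theta> k / \<theta>0) *\<^sub>R (z' - Z s k), z')"
proof -
  have XZ: "approx gradf \<psi> v \<tau> x0 s k = (X s k, Z s k)" by (simp add: X_def Z_def)
  have coef: "real CARD('n) / \<tau> * \<theta> k = \<theta> k / \<theta>0" by (simp add: theta0_def)
  have z': "z' = (\<chi> i. if i \<in> s k then arg_min (\<lambda>u. ereal (gradf (Y s k) $ i * (u - Y s k $ i)
      + \<theta> k * real CARD('n) * v $ i / (2 * \<tau>) * \<bar>u - Z s k $ i\<bar>\<^sup>2) + \<psi> i u) (\<lambda>_. True) else Z s k $ i)"
    by (simp only: z'_def select_def full_step_def vec_lambda_beta)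
  show ?thesis
    unfolding approx.simps Let_def XZ prod.case theta0_def[symmetric] Y_def[symmetric] coef z' ..
qed

lemma Z_Suc: "Z s (Suc k) = select (s k) (full_step (\<theta> k) (Y s k) (Z s k)) (Z s k)"
  unfolding Z_def[of s "Suc k"] approx_Suc snd_conv ..

lemma X_Suc: "X s (Suc k) = Y s k + (\<theta> k / \<theta>0) *\<^sub>R (Z s (Suc k) - Z s k)"
  unfolding X_def[of s "Suc k"] Z_Suc approx_Suc fst_conv ..

lemma approx_cong:
  "(\<And>j. j < k \<Longrightarrow> s j = s' j) \<Longrightarrow> approx gradf \<psi> v \<tau> x0 s k = approx gradf \<psi> v \<tau> x0 s' k"
proof (induction k)
  case (Suc k)
  then have "approx gradf \<psi> v \<tau> x0 s k = approx gradf \<psi> v \<tau> x0 s' k" "s k = s' k" by auto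
  then show ?case by (simp only: approx.simps)
qed simp

lemma XZ_cong:
  assumes "\<And>j. j < k \<Longrightarrow> s j = s' j"
  shows "X s k = X s' k" "Z s k = Z s' k"
  using approx_cong[OF assms] by (auto simp: X_def Z_def)

lemma Psihat_cong: "(\<And>j. j < k \<Longrightarrow> s j = s' j) \<Longrightarrow> Psihat s k = Psihat s' k"
proof (induction k)
  case (Suc k)
  have "Z s (Suc k) = Z s' (Suc k)" by (rule XZ_cong(2)[OF Suc.prems])
  moreover have "Z s k = Z s' k" using Suc.prems by (intro XZ_cong(2)) auto
  ultimately show ?case using Suc by simp
qed simp

lemma R_cong: "(\<And>j. j < k \<Longrightarrow> s j = s' j) \<Longrightarrow> R s k = R s' k"
proof (induction k)
  case (Suc k)
  have "X s k = X s' k" using Suc.prems by (intro XZ_cong(1)) auto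
  then show ?case using Suc by simp
qed simp

lemma Z_dom: "Z s k \<in> psi_dom"
proof (induction k)
  case (Suc k)
  have "full_step (\<theta> k) (Y s k) (Z s k) \<in> psi_dom"
    by (rule full_step_dom[OF theta_pos[OF theta0_bounds]])
  with Suc show ?case unfolding Z_Suc by (auto simp: psi_dom_def select_def)
qed (simp add: x0)

lemma mix_keep_zero:
  assumes "weight \<theta>0 (Suc k) = 1"
  shows "mix \<theta>0 k = 0" "keep \<theta>0 k * (1 - weight \<theta>0 k) = 0"
proof -
  have "keep \<theta>0 k * (1 - weight \<theta>0 k) \<ge> 0"
    using mix_nonneg[OF theta0_bounds, of k] weight_bounds[OF theta0_bounds, of k] by simp
  then show "mix \<theta>0 k = 0" "keep \<theta>0 k * (1 - weight \<theta>0 k) = 0"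
    using mix_plus_keep(1)[OF theta0_bounds, of k] mix_nonneg(1)[OF theta0_bounds, of k] assms by linarith+
qed

text \<open>
  The step is a convex combination, so it propagates any convex function. It is used for \<open>\<Psi>\<close> on its
  domain and for the squared distance to \<open>xs\<close> on the whole space.
\<close>
lemma R_step:
  assumes "convex_on C \<Phi>" "X s k \<in> C" "R s k \<in> C" "x0 \<in> C"
  shows "R s (Suc k) \<in> C"
    and "(1 - weight \<theta>0 (Suc k)) * \<Phi> (R s (Suc k))
      \<le> mix \<theta>0 k * \<Phi> (X s k) + keep \<theta>0 k * ((1 - weight \<theta>0 k) * \<Phi> (R s k))"
proof -
  let ?a = "mix \<theta>0 k" and ?b = "keep \<theta>0 k * (1 - weight \<theta>0 k)"
  have ab: "0 \<le> ?a" "0 \<le> ?b"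
    using mix_nonneg[OF theta0_bounds, of k] weight_bounds[OF theta0_bounds, of k] by auto
  have sum: "1 - weight \<theta>0 (Suc k) = ?a + ?b" using mix_plus_keep(1)[OF theta0_bounds] by simp
  have "R s (Suc k) \<in> C \<and> (1 - weight \<theta>0 (Suc k)) * \<Phi> (R s (Suc k)) \<le> ?a * \<Phi> (X s k) + ?b * \<Phi> (R s k)"
  proof (cases "weight \<theta>0 (Suc k) = 1")
    case True
    then show ?thesis using mix_keep_zero[OF True] assms by auto
  next
    case False
    then have "0 < ?a + ?b" using sum weight_bounds[OF theta0_bounds, of "Suc k"] by linarith
    then show ?thesis
      using convex_on_scaled_combination[OF assms(1-3) ab] False by (simp add: sum)
  qed
  then show "R s (Suc k) \<in> C" and "(1 - weight \<theta>0 (Suc k)) * \<Phi> (R s (Suc k))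
      \<le> mix \<theta>0 k * \<Phi> (X s k) + keep \<theta>0 k * ((1 - weight \<theta>0 k) * \<Phi> (R s k))"
    by (simp_all add: mult.assoc)
qed

text \<open>
  The update adds \<open>g\<^sub>k\<^sub>+\<^sub>1 z\<^sub>k\<^sub>+\<^sub>1\<close> to \<open>(1 - \<theta>\<^sub>k) x\<^sub>k - (g\<^sub>k\<^sub>+\<^sub>1 - \<theta>\<^sub>k) z\<^sub>k\<close>. Since
  \<open>keep\<^sub>k g\<^sub>k = g\<^sub>k\<^sub>+\<^sub>1 - \<theta>\<^sub>k\<close>, the latter is \<open>mix\<^sub>k x\<^sub>k + keep\<^sub>k (x\<^sub>k - g\<^sub>k z\<^sub>k)\<close>, where the negative
  term is absorbed.
\<close>
lemma X_split: "X s k = weight \<theta>0 k *\<^sub>R Z s k + (1 - weight \<theta>0 k) *\<^sub>R R s k"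
proof (induction k)
  case 0
  then show ?case by (simp add: weight_def)
next
  case (Suc k)
  let ?w = "weight \<theta>0 k" and ?w' = "weight \<theta>0 (Suc k)"
  have R: "(1 - ?w') *\<^sub>R R s (Suc k) = mix \<theta>0 k *\<^sub>R X s k + (keep \<theta>0 k * (1 - ?w)) *\<^sub>R R s k"
    using mix_keep_zero[of k] by (cases "?w' = 1") auto
  have "X s (Suc k) = ?w' *\<^sub>R Z s (Suc k) + ((1 - \<theta> k) *\<^sub>R X s k - (?w' - \<theta> k) *\<^sub>R Z s k)"
    unfolding X_Suc Y_def by (simp add: weight_def algebra_simps del: theta.simps)
  also have "(1 - \<theta> k) *\<^sub>R X s k - (?w' - \<theta> k) *\<^sub>R Z s k
      = mix \<theta>0 k *\<^sub>R X s k + keep \<theta>0 k *\<^sub>R (X s k - ?w *\<^sub>R Z s k)"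
    unfolding mix_plus_keep(2)[OF theta0_bounds, symmetric] mix_def by (simp add: algebra_simps del: theta.simps)
  also have "X s k - ?w *\<^sub>R Z s k = (1 - ?w) *\<^sub>R R s k"
    using Suc by (simp add: algebra_simps)
  also have "mix \<theta>0 k *\<^sub>R X s k + keep \<theta>0 k *\<^sub>R (1 - ?w) *\<^sub>R R s k = (1 - ?w') *\<^sub>R R s (Suc k)"
    unfolding R by simp
  finally show ?case .
qed

lemma convex_X_split:
  assumes "convex_on C \<Phi>" "Z s k \<in> C" "R s k \<in> C"
  shows "X s k \<in> C" "\<Phi> (X s k) \<le> weight \<theta>0 k * \<Phi> (Z s k) + (1 - weight \<theta>0 k) * \<Phi> (R s k)"
  unfolding X_split[of s k] using assms weight_bounds[OF theta0_bounds, of k]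
  by (auto simp: convex_on_def convex_def)

lemma R_dom: "R s k \<in> psi_dom"
proof (induction k)
  case (Suc k)
  have "X s k \<in> psi_dom" by (rule convex_X_split(1)[OF Psi_convex Z_dom Suc])
  then show ?case by (rule R_step(1)[OF Psi_convex _ Suc x0])
qed (simp add: x0)

lemma X_dom: "X s k \<in> psi_dom"
  by (rule convex_X_split(1)[OF Psi_convex Z_dom R_dom])

text \<open>
  The statement is sharper than \<open>\<Psi>(x\<^sub>k) \<le> Psihat\<^sub>k\<close>, which follows by convexity but is too weak for
  the induction: it does not account for the part of \<open>Psihat\<close> that comes from \<open>z\<^sub>k\<close> alone.
\<close>
lemma Psi_R_le_Psihat:
  "weight \<theta>0 k * Psi (Z s k) + (1 - weight \<theta>0 k) * Psi (R s k) \<le> Psihat s k"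
proof (induction k)
  case 0
  then show ?case by (simp add: weight_def)
next
  case (Suc k)
  let ?w = "weight \<theta>0 k" and ?w' = "weight \<theta>0 (Suc k)"
  note Xk = convex_X_split(2)[OF Psi_convex Z_dom[of s k] R_dom[of s k]]
  have "(1 - ?w') * Psi (R s (Suc k)) \<le> mix \<theta>0 k * Psi (X s k) + keep \<theta>0 k * ((1 - ?w) * Psi (R s k))"
    by (rule R_step(2)[OF Psi_convex X_dom R_dom x0])
  also have "\<dots> \<le> mix \<theta>0 k * Psihat s k + keep \<theta>0 k * (Psihat s k - ?w * Psi (Z s k))"
    using Suc Xk mix_nonneg[OF theta0_bounds, of k] by (intro add_mono mult_left_mono) auto
  also have "\<dots> = (1 - \<theta> k) * Psihat s k - (keep \<theta>0 k * ?w) * Psi (Z s k)"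
    unfolding mix_def by (simp add: algebra_simps del: theta.simps)
  also have "\<dots> = Psihat s (Suc k) - ?w' * Psi (Z s (Suc k))"
    unfolding mix_plus_keep(2)[OF theta0_bounds] by (simp add: weight_def algebra_simps del: theta.simps)
  finally show ?case by simp
qed

lemma Psi_X_le_Psihat: "Psi (X s k) \<le> Psihat s k"
  using convex_X_split(2)[OF Psi_convex Z_dom R_dom] Psi_R_le_Psihat by (rule order_trans)

definition potential :: "nat \<Rightarrow> (nat \<Rightarrow> 'n set) \<Rightarrow> real" where
  "potential k s = level \<theta>0 k * (f (X s k) + Psihat s k - (f xs + Psi xs)) + Q (Z s k - xs) / (2 * \<theta>0\<^sup>2)"

text \<open>
  This is \<open>one_step\<close> divided by \<open>\<theta>\<^sub>k\<^sup>2\<close>, since \<open>(1 - \<theta>\<^sub>k) / \<theta>\<^sub>k\<^sup>2\<close> is the previous level.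
\<close>
lemma potential_step:
  "measure_pmf.expectation P (\<lambda>t. potential (Suc k) (s(k := t))) \<le> potential k s"
proof -
  let ?t = "\<theta> k" and ?Fs = "f xs + Psi xs"
  let ?zt = "full_step ?t (Y s k) (Z s k)"
  define H where "H t = f (Y s k + (?t / \<theta>0) *\<^sub>R (select t ?zt (Z s k) - Z s k))
        + ((1 - ?t) * Psihat s k + ?t * Psi (Z s k) + ?t / \<theta>0 * (Psi (select t ?zt (Z s k)) - Psi (Z s k)))
        + ?t\<^sup>2 / (2 * \<theta>0\<^sup>2) * Q (select t ?zt (Z s k) - xs)" for t
  have t: "0 < ?t" "?t \<le> 1" using theta_pos[OF theta0_bounds, of k] theta_le[OF theta0_bounds, of k] theta0_bounds by auto
  have old: "X (s(k := t)) k = X s k" "Z (s(k := t)) k = Z s k" "Psihat (s(k := t)) k = Psihat s k" for t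
    by (auto intro!: XZ_cong Psihat_cong)
  have "potential (Suc k) (s(k := t)) = 1 / ?t\<^sup>2 * (H t - ?Fs)" for t
  proof -
    have "Y (s(k := t)) k = Y s k" by (simp add: Y_def old)
    then have Z': "Z (s(k := t)) (Suc k) = select t ?zt (Z s k)"
      by (simp add: Z_Suc old del: theta.simps)
    have X': "X (s(k := t)) (Suc k) = Y s k + (?t / \<theta>0) *\<^sub>R (select t ?zt (Z s k) - Z s k)"
      unfolding X_Suc Z' by (simp add: Y_def old)
    show ?thesis
      unfolding potential_def H_def X' Z' Psihat.simps old
      using t by (simp add: level_def field_simps del: theta.simps)
  qed
  then have "measure_pmf.expectation P (\<lambda>t. potential (Suc k) (s(k := t)))
      = 1 / ?t\<^sup>2 * (measure_pmf.expectation P H - ?Fs)"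
    by simp
  also have "\<dots> \<le> 1 / ?t\<^sup>2 * ((1 - ?t) * (f (X s k) + Psihat s k) + ?t * ?Fs
      + ?t\<^sup>2 / (2 * \<theta>0\<^sup>2) * Q (Z s k - xs) - ?Fs)"
    unfolding H_def Y_def
    by (intro mult_left_mono diff_right_mono one_step[OF t xs]) simp
  also have "\<dots> = potential k s"
    unfolding potential_def level_eq[OF theta0_bounds, of k]
    using t by (simp add: level_def field_simps del: theta.simps)
  finally show ?thesis .
qed

definition Delta0 :: real where
  "Delta0 = (1 - \<theta>0) / \<theta>0\<^sup>2 * (f x0 + Psi x0 - (f xs + Psi xs)) + Q (x0 - xs) / (2 * \<theta>0\<^sup>2)"

text \<open>
  The expectations of the gap and of the three squared distances satisfy the hypotheses of
  \<open>rate_of_coupled_recursion\<close>: the descent comes from the potential and the tower property, all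
  other inequalities hold for every run.
\<close>
lemma expected_rate:
  fixes M :: "'w measure" and S :: "nat \<Rightarrow> 'w \<Rightarrow> 'n set"
  assumes prob: "prob_space M"
    and indep: "prob_space.indep_vars M (\<lambda>_. count_space UNIV) S UNIV"
    and law: "\<And>j. distr M (count_space UNIV) (S j) = measure_pmf P"
    and k: "k \<ge> 1"
  defines "h \<equiv> (\<lambda>\<omega>. (1 - \<theta>0) / \<theta>0\<^sup>2 * (f (X (\<lambda>j. S j \<omega>) k) + Psi (X (\<lambda>j. S j \<omega>) k) - (f xs + Psi xs))
      + Q (X (\<lambda>j. S j \<omega>) k - xs) / (2 * \<theta>0\<^sup>2))"
  shows "integrable M h"
    and "integral\<^sup>L M h \<le> (1 + (1 - \<theta>0) / \<theta>0\<^sup>2 * (\<mu> * \<theta>0\<^sup>2)) / (1 + \<mu> * \<theta>0\<^sup>2 / (2 * (\<theta> (k - 1))\<^sup>2)) * Delta0"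
proof -
  interpret prob_space M by (rule prob)
  define E where "E \<Phi> = expectation (\<lambda>\<omega>. \<Phi> (\<lambda>j. S j \<omega>))" for \<Phi> :: "(nat \<Rightarrow> 'n set) \<Rightarrow> real"
  define g where "g k s = f (X s k) + Psi (X s k) - (f xs + Psi xs)" for k s
  define d where "d k s = Q (X s k - xs) / (2 * \<theta>0\<^sup>2)" for k s
  define w where "w k s = Q (Z s k - xs) / (2 * \<theta>0\<^sup>2)" for k s
  define r where "r k s = (1 - weight \<theta>0 k) * (Q (R s k - xs) / (2 * \<theta>0\<^sup>2))" for k s
  note [simp del] = theta.simps
  have same: "X s k = X s' k \<and> Z s k = Z s' k \<and> Psihat s k = Psihat s' k \<and> R s k = R s' k"
    if "\<forall>j<k. s j = s' j" for s s' k
    using that XZ_cong[of k s s'] Psihat_cong[of k s s'] R_cong[of k s s'] by blast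
  have det: "determined k (g k)" "determined k (d k)" "determined k (w k)" "determined k (r k)"
    "determined k (potential k)" for k
    unfolding determined_def g_def d_def w_def r_def potential_def
    by (auto dest!: same)
  note int = det[THEN integrable_determined[OF indep]]
  have E_mono: "E \<Phi> \<le> E \<Phi>'"
    if "integrable M (\<lambda>\<omega>. \<Phi> (\<lambda>j. S j \<omega>))" "integrable M (\<lambda>\<omega>. \<Phi>' (\<lambda>j. S j \<omega>))" "\<And>s. \<Phi> s \<le> \<Phi>' s" for \<Phi> \<Phi>'
    unfolding E_def using that by (intro integral_mono)
  have E_lin: "E (\<lambda>s. a * \<Phi> s + b * \<Phi>' s) = a * E \<Phi> + b * E \<Phi>'"
    if "integrable M (\<lambda>\<omega>. \<Phi> (\<lambda>j. S j \<omega>))" "integrable M (\<lambda>\<omega>. \<Phi>' (\<lambda>j. S j \<omega>))" for \<Phi> \<Phi>' a b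
    unfolding E_def using that by simp
  have Qc: "convex_on UNIV (\<lambda>x. Q (x - xs) / (2 * \<theta>0\<^sup>2))"
    using convex_on_cmul[OF _ convex_on_wnorm_sq[OF v_pos, of xs], of "1 / (2 * \<theta>0\<^sup>2)"] by simp
  have pot_decr: "E (potential k) \<le> Delta0" for k
  proof (induction k)
    case 0
    have "E (potential 0) = Delta0"
      unfolding E_def potential_def Delta0_def by (simp add: level_def prob_space)
    then show ?case by simp
  next
    case (Suc k)
    have "E (potential (Suc k)) = expectation (\<lambda>\<omega>. measure_pmf.expectation P (\<lambda>t. potential (Suc k) ((\<lambda>j. S j \<omega>)(k := t))))"
      unfolding E_def by (rule expectation_last_draw[OF indep law det(5)])
    also have "\<dots> \<le> E (potential k)"
      unfolding E_def
    proof (intro integral_mono potential_step int)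
      have "determined k (\<lambda>s. measure_pmf.expectation P (\<lambda>t. potential (Suc k) (s(k := t))))"
        unfolding determined_def
      proof (intro allI impI)
        fix s s' :: "nat \<Rightarrow> 'n set" assume "\<forall>j<k. s j = s' j"
        then have "potential (Suc k) (s(k := t)) = potential (Suc k) (s'(k := t))" for t
          by (intro determinedD[OF det(5)]) (auto simp: less_Suc_eq)
        then show "measure_pmf.expectation P (\<lambda>t. potential (Suc k) (s(k := t)))
          = measure_pmf.expectation P (\<lambda>t. potential (Suc k) (s'(k := t)))" by simp
      qed
      then show "integrable M (\<lambda>\<omega>. measure_pmf.expectation P (\<lambda>t. potential (Suc k) ((\<lambda>j. S j \<omega>)(k := t))))"
        by (rule integrable_determined[OF indep])
    qed
    finally show ?case using Suc by simp
  qed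
  have descent: "level \<theta>0 k * E (g k) + E (w k) \<le> Delta0" for k
  proof -
    have "level \<theta>0 k * E (g k) + 1 * E (w k) = E (\<lambda>s. level \<theta>0 k * g k s + 1 * w k s)"
      by (rule E_lin[symmetric, OF int(1) int(3)])
    also have "\<dots> \<le> E (potential k)"
    proof (rule E_mono)
      show "level \<theta>0 k * g k s + 1 * w k s \<le> potential k s" for s
        unfolding potential_def g_def w_def using Psi_X_le_Psihat[of s k] theta0_bounds
        by (auto simp: level_def intro!: mult_left_mono divide_right_mono split: nat.split)
    qed (use int in auto)
    finally show ?thesis using pot_decr[of k] by simp
  qed
  have quad: "\<mu> * \<theta>0\<^sup>2 * E (d k) \<le> E (g k)" for k
  proof -
    have "\<mu> * \<theta>0\<^sup>2 * E (d k) = E (\<lambda>s. \<mu> * \<theta>0\<^sup>2 * d k s)" by (simp add: E_def)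
    also have "\<dots> \<le> E (g k)"
    proof (rule E_mono)
      show "\<mu> * \<theta>0\<^sup>2 * d k s \<le> g k s" for s
        using growth[OF X_dom[of s k]] theta0_bounds by (simp add: d_def g_def)
    qed (use int in auto)
    finally show ?thesis .
  qed
  have split: "E (d k) \<le> weight \<theta>0 k * E (w k) + E (r k)" for k
  proof -
    have "E (d k) \<le> E (\<lambda>s. weight \<theta>0 k * w k s + 1 * r k s)"
    proof (rule E_mono)
      show "d k s \<le> weight \<theta>0 k * w k s + 1 * r k s" for s
        using convex_X_split(2)[OF Qc, of s k] by (simp add: d_def w_def r_def)
    qed (use int in auto)
    also have "\<dots> = weight \<theta>0 k * E (w k) + 1 * E (r k)"
      by (rule E_lin[OF int(3,4)])
    finally show ?thesis by simp
  qed
  have rest: "E (r (Suc k)) \<le> mix \<theta>0 k * E (d k) + keep \<theta>0 k * E (r k)" for k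
  proof -
    have "E (r (Suc k)) \<le> E (\<lambda>s. mix \<theta>0 k * d k s + keep \<theta>0 k * r k s)"
    proof (rule E_mono)
      show "r (Suc k) s \<le> mix \<theta>0 k * d k s + keep \<theta>0 k * r k s" for s
        using R_step(2)[OF Qc, of s k] by (simp only: d_def r_def UNIV_I)
    qed (use int in auto)
    also have "\<dots> = mix \<theta>0 k * E (d k) + keep \<theta>0 k * E (r k)"
      by (rule E_lin[OF int(2,4)])
    finally show ?thesis .
  qed
  have rest1: "E (r 1) \<le> 0"
    using theta0_bounds by (simp add: E_def r_def weight_def theta.simps)
  have Delta0_nonneg: "Delta0 \<ge> 0"
  proof -
    have "f xs + Psi xs \<le> f x0 + Psi x0"
      using growth[OF x0] mu by (smt (verit) divide_nonneg_pos mult_nonneg_nonneg zero_le_power2)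
    then show ?thesis unfolding Delta0_def using theta0_bounds by simp
  qed
  have h: "h = (\<lambda>\<omega>. (1 - \<theta>0) / \<theta>0\<^sup>2 * g k (\<lambda>j. S j \<omega>) + 1 * d k (\<lambda>j. S j \<omega>))"
    by (simp add: h_def g_def d_def)
  show "integrable M h" unfolding h using int by simp
  have "integral\<^sup>L M h = (1 - \<theta>0) / \<theta>0\<^sup>2 * E (g k) + E (d k)"
    using E_lin[OF int(1,2), of "(1 - \<theta>0) / \<theta>0\<^sup>2" k 1 k] unfolding h E_def by simp
  also have "\<dots> \<le> (1 + (1 - \<theta>0) / \<theta>0\<^sup>2 * (\<mu> * \<theta>0\<^sup>2)) / (1 + \<mu> * \<theta>0\<^sup>2 / (2 * (\<theta> (k - 1))\<^sup>2)) * Delta0"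
    using mu theta0_bounds by (intro rate_of_coupled_recursion[where w = "\<lambda>k. E (w k)" and Pr = "\<lambda>k. E (r k)"]
        descent quad split rest rest1 Delta0_nonneg k) auto
  finally show "integral\<^sup>L M h \<le> (1 + (1 - \<theta>0) / \<theta>0\<^sup>2 * (\<mu> * \<theta>0\<^sup>2)) / (1 + \<mu> * \<theta>0\<^sup>2 / (2 * (\<theta> (k - 1))\<^sup>2)) * Delta0" .
qed

end

section \<open>Minimizers of the composite function\<close>

lemma min_value_eq:
  assumes "x \<in> minimizers F"
  shows "min_value F = F x"
  using assms unfolding min_value_def minimizers_def is_arg_min_def
  by (intro antisym INF_lower INF_greatest) (auto simp: not_less)

context coordinate_problem
begin

lemma composite_on_dom:
  assumes "x \<in> psi_dom" shows "composite f \<psi> x = ereal (f x + Psi x)"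
proof -
  have "separable_sum \<psi> x = (\<Sum>i\<in>UNIV. ereal (real_of_ereal (\<psi> i (x $ i))))"
    unfolding separable_sum_def using assms by (intro sum.cong) (auto simp: psi_dom_def edom_real[OF psi, symmetric])
  then show ?thesis by (simp add: composite_def Psi_def)
qed

lemma separable_sum_off_dom:
  assumes "x \<notin> psi_dom" shows "separable_sum \<psi> x = \<infinity>"
  unfolding separable_sum_def using assms by (simp add: sum_Pinfty psi_dom_def edom_def)

lemma composite_off_dom: "x \<notin> psi_dom \<Longrightarrow> composite f \<psi> x = \<infinity>"
  by (simp add: composite_def separable_sum_off_dom)

text \<open>
  A point in the domain makes the minimum finite.
\<close>
lemma minimizer_in_dom:
  assumes "x \<in> minimizers (composite f \<psi>)" "x0 \<in> psi_dom"
  shows "x \<in> psi_dom"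
proof (rule ccontr)
  assume "x \<notin> psi_dom"
  then have "composite f \<psi> x0 < composite f \<psi> x"
    using composite_on_dom[OF assms(2)] composite_off_dom by simp
  with assms(1) show False by (auto simp: minimizers_def is_arg_min_def)
qed

lemma quadratic_growth:
  assumes sc: "strongly_convex_wrt v \<mu> (composite f \<psi>)"
    and xs: "xs \<in> minimizers (composite f \<psi>)" "xs \<in> psi_dom" and x: "x \<in> psi_dom"
  shows "f xs + Psi xs + \<mu> / 2 * Q (x - xs) \<le> f x + Psi x"
proof (rule le_of_interpolation)
  fix t :: real assume t: "0 < t" "t < 1"
  let ?m = "(1 - t) *\<^sub>R xs + t *\<^sub>R x"
  have sym: "Q (xs - x) = Q (x - xs)"
    unfolding wnorm_sq[OF v_pos] by (simp add: power2_commute)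
  have "ereal (f xs + Psi xs) \<le> composite f \<psi> ?m"
    using xs(1) unfolding composite_on_dom[OF xs(2), symmetric]
    by (auto simp: minimizers_def is_arg_min_def not_less)
  also have "\<dots> \<le> ereal (1 - t) * composite f \<psi> xs + ereal t * composite f \<psi> x
      - ereal (\<mu> / 2 * t * (1 - t) * Q (xs - x))"
    using sc t unfolding strongly_convex_wrt_def by blast
  also have "\<dots> = ereal ((1 - t) * (f xs + Psi xs) + t * (f x + Psi x) - \<mu> / 2 * Q (x - xs) * t * (1 - t))"
    unfolding composite_on_dom[OF xs(2)] composite_on_dom[OF x] sym by (simp add: mult_ac)
  finally show "f xs + Psi xs \<le> (1 - t) * (f xs + Psi xs) + t * (f x + Psi x)
      - \<mu> / 2 * Q (x - xs) * t * (1 - t)" by simp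
qed

lemma minimizers_singleton:
  assumes sc: "strongly_convex_wrt v \<mu> (composite f \<psi>)" and mu: "\<mu> > 0"
    and xs: "xs \<in> minimizers (composite f \<psi>)" "xs \<in> psi_dom"
  shows "minimizers (composite f \<psi>) = {xs}"
proof -
  have "x = xs" if x: "x \<in> minimizers (composite f \<psi>)" for x
  proof -
    have xd: "x \<in> psi_dom" by (rule minimizer_in_dom[OF x xs(2)])
    have "composite f \<psi> x \<le> composite f \<psi> xs"
      using x by (auto simp: minimizers_def is_arg_min_def not_less)
    then have "f x + Psi x \<le> f xs + Psi xs"
      by (simp add: composite_on_dom xd xs)
    then have "\<mu> / 2 * Q (x - xs) \<le> 0"
      using quadratic_growth[OF sc xs xd] by simp
    then have "Q (x - xs) \<le> 0" using mu by (simp add: mult_le_0_iff)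
    then have "Q (x - xs) = 0" by simp
    then show "x = xs" using wnorm_eq_0_iff[OF v_pos, of "x - xs"] by simp
  qed
  with xs show ?thesis by blast
qed

lemma Delta_on_dom:
  assumes sc: "strongly_convex_wrt v \<mu> (composite f \<psi>)" and mu: "\<mu> > 0"
    and xs: "xs \<in> minimizers (composite f \<psi>)" "xs \<in> psi_dom" and x: "x \<in> psi_dom"
  shows "Delta \<theta>0 v (composite f \<psi>) x
    = ereal ((1 - \<theta>0) / \<theta>0\<^sup>2 * (f x + Psi x - (f xs + Psi xs)) + Q (x - xs) / (2 * \<theta>0\<^sup>2))"
  unfolding Delta_def minimizers_singleton[OF sc mu xs] min_value_eq[OF xs(1)]
    composite_on_dom[OF xs(2)] composite_on_dom[OF x]
  by (simp add: wdist_def)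

end

section \<open>The rate in expectation\<close>

lemma ereal_expectation_ereal:
  assumes "integrable M h" "\<And>\<omega>. h \<omega> \<ge> 0"
  shows "ereal_expectation M (\<lambda>\<omega>. ereal (h \<omega>)) = ereal (integral\<^sup>L M h)"
proof -
  have "(\<integral>\<^sup>+ \<omega>. e2ennreal (ereal (h \<omega>)) \<partial>M) = (\<integral>\<^sup>+ \<omega>. ennreal (h \<omega>) \<partial>M)"
    by simp
  also have "\<dots> = ennreal (integral\<^sup>L M h)"
    using assms by (intro nn_integral_eq_integral) auto
  finally show ?thesis
    unfolding ereal_expectation_def using assms(2) by (simp add: enn2ereal_ennreal)
qed

theorem theorem1:
  fixes f :: "real ^ 'n::finite \<Rightarrow> real"
    and gradf :: "real ^ 'n \<Rightarrow> real ^ 'n"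
    and \<psi> :: "'n \<Rightarrow> real \<Rightarrow> ereal"
    and F :: "real ^ 'n \<Rightarrow> ereal"
    and v x0 :: "real ^ 'n"
    and P :: "'n set pmf"
    and \<tau> \<mu> \<theta>0 :: real
    and M :: "'w measure"
    and S :: "nat \<Rightarrow> 'w \<Rightarrow> 'n set"
    and k :: nat
  assumes f_convex: "convex_on UNIV f"
    and f_grad: "\<And>x. GDERIV f x :> gradf x"
    and psi: "\<And>i. closed_proper_convex (\<psi> i)"
    and F_def: "F = composite f \<psi>"
    and minimizers_nonempty: "minimizers F \<noteq> {}"
    and v_pos: "\<And>i. v $ i > 0"
    and uniform: "uniform_sampling P"
    and tau_def: "\<tau> = mean_size P"
    and tau_pos: "\<tau> > 0"
    and eso: "ESO f gradf P v"
    and mu_pos: "\<mu> > 0"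
    and strongly_convex: "strongly_convex_wrt v \<mu> F"
    and theta0_def: "\<theta>0 = \<tau> / real CARD('n)"
    and x0_dom: "x0 \<in> edom (separable_sum \<psi>)"
    and prob: "prob_space M"
    and draws_indep: "prob_space.indep_vars M (\<lambda>_. count_space UNIV) S UNIV"
    and draws_law: "\<And>j. distr M (count_space UNIV) (S j) = measure_pmf P"
    and k_ge_1: "k \<ge> 1"
  shows "ereal_expectation M (\<lambda>\<omega>. Delta \<theta>0 v F (approx_x gradf \<psi> v \<tau> x0 (\<lambda>j. S j \<omega>) k))
           \<le> ereal ((1 + (1 - \<theta>0) * \<mu>) / (1 + \<theta>0\<^sup>2 / (2 * (theta \<theta>0 (k - 1))\<^sup>2) * \<mu>))
               * Delta \<theta>0 v F x0"
proof -
  interpret coordinate_problem f gradf \<psi> v P \<tau> \<theta>0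
    by unfold_locales (fact f_convex f_grad psi v_pos uniform tau_def tau_pos eso theta0_def)+
  obtain xs where xs_min: "xs \<in> minimizers (composite f \<psi>)"
    using minimizers_nonempty unfolding F_def by blast
  have x0_in_dom: "x0 \<in> psi_dom"
    using x0_dom separable_sum_off_dom[of x0] by (auto simp: edom_def)
  have xs_dom: "xs \<in> psi_dom" by (rule minimizer_in_dom[OF xs_min x0_in_dom])
  note sc = strongly_convex[unfolded F_def]
  interpret approx_run f gradf \<psi> v P \<tau> \<theta>0 x0 xs \<mu>
    using x0_in_dom xs_dom mu_pos quadratic_growth[OF sc xs_min xs_dom] by unfold_locales auto
  note Delta_eq = Delta_on_dom[OF sc mu_pos xs_min xs_dom]
  let ?s = "\<lambda>\<omega> j. S j \<omega>"
  define h where "h = (\<lambda>\<omega>. (1 - \<theta>0) / \<theta>0\<^sup>2 * (f (X (?s \<omega>) k) + Psi (X (?s \<omega>) k) - (f xs + Psi xs))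
      + Q (X (?s \<omega>) k - xs) / (2 * \<theta>0\<^sup>2))"
  note rate = expected_rate[OF prob draws_indep draws_law k_ge_1, folded h_def]
  have h_nonneg: "h \<omega> \<ge> 0" for \<omega>
  proof -
    have "0 \<le> \<mu> / 2 * Q (X (?s \<omega>) k - xs)" using mu_pos by simp
    then have "f xs + Psi xs \<le> f (X (?s \<omega>) k) + Psi (X (?s \<omega>) k)"
      using growth[OF X_dom[of "?s \<omega>" k]] by linarith
    then show ?thesis using theta0_bounds by (simp add: h_def)
  qed
  have "Delta \<theta>0 v F (approx_x gradf \<psi> v \<tau> x0 (?s \<omega>) k) = ereal (h \<omega>)" for \<omega>
    using Delta_eq[OF X_dom[of "?s \<omega>" k]] unfolding F_def approx_x_def h_def X_def .
  then have "ereal_expectation M (\<lambda>\<omega>. Delta \<theta>0 v F (approx_x gradf \<psi> v \<tau> x0 (?s \<omega>) k)) = ereal (integral\<^sup>L M h)"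
    using ereal_expectation_ereal[OF rate(1) h_nonneg] by simp
  also have "\<dots> \<le> ereal ((1 + (1 - \<theta>0) / \<theta>0\<^sup>2 * (\<mu> * \<theta>0\<^sup>2)) / (1 + \<mu> * \<theta>0\<^sup>2 / (2 * (theta \<theta>0 (k - 1))\<^sup>2)) * Delta0)"
    using rate(2) by simp
  also have "\<dots> = ereal ((1 + (1 - \<theta>0) * \<mu>) / (1 + \<theta>0\<^sup>2 / (2 * (theta \<theta>0 (k - 1))\<^sup>2) * \<mu>)) * Delta \<theta>0 v F x0"
    unfolding F_def Delta_eq[OF x0_in_dom] Delta0_def[symmetric] using theta0_bounds by (simp add: mult.commute)
  finally show ?thesis .
qed

end
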